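(* Let $X$ be a separable Banach space such that $X^*$ has the very strong Schur property. Assume that $X$ is linearly isomorphic to a subspace of a Banach space with a (UFDD). Then $X$ is linearly isomorphic to a subspace of $c_0$.
   Context: A (UFDD) is an unconditional finite-dimensional decomposition: a sequence of finite-rank projections $(Q_n)$ with $Q_mQ_n=0$ for $m\ne n$ such that $x=\sum_n Q_nx$ with unconditional convergence for every $x$ in the space. Subspaces are closed. Trees: let $\mathcal F\mathbb N$ be the set of all finite subsets of $\mathbb N$, partially ordered by: $a\le b$ iff, writing $a=\{n_1<\dots<n_k\}$ and $b=\{m_1<\dots<m_l\}$, we have $k\le l$ and $m_i=n_i$ for $1\le i\le k$ (i.e. $a$ is an initial segment of $b$). $b$ is a successor of $a$ if $a\le b$ and $|b|=|a|+1$; $a+$ denotes the collection of successors of $a$; for $a\neq\emptyset$, $a-$ is the unique predecessor of $a$. A full tree is a set $S\subset\mathcal F\mathbb N$ such that (1) $\emptyset\in S$; (2) each $a\in S$ has infinitely many successors in $S$; (3) if $\emptyset\ne a\in S$ then $a-\in S$. A branch of $S$ is a sequence $\beta=\{a_n\}_{n=0}^\infty$ in $S$ with $a_0=\emptyset$ and $a_{n+1}$ a successor of $a_n$ for all $n\ge0$. A tree-assignment in a vector space $V$ is a map $a\mapsto x_a\in V$ defined on a full tree $S$. Very strong Schur property: for $\delta>0$, a tree-assignment $(x_a)_{a\in S}$ in a Banach space $Y$ is $\delta$-separated if $\|x_b-x_{b'}\|\ge\delta$ whenever $b\ne b'$ in $S$ satisfy $b,b'\in a+$ for some $a\in S$.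 $Y$ has the very strong Schur property if there is a constant $c>0$ such that whenever $(x_a)_{a\in S}$ is a $\delta$-separated bounded tree-assignment in $Y$, there are a branch $\beta$ of $S$ and $x^*\in B_{Y^*}$ (the closed unit ball of $Y^*$) with $|x^*(x_a)|\ge c\delta$ whenever $\emptyset\ne a\in\beta$. *)

theory Defs
  imports "HOL-Analysis.Analysis" "HOL-Library.Sublist"
begin

text \<open>
  A finite set of natural numbers is identified with its increasing enumeration.
  Since \<^const>\<open>sorted_list_of_set\<close> returns the empty list on infinite sets, finiteness is
  required explicitly.
\<close>

definition tree_le :: "nat set \<Rightarrow> nat set \<Rightarrow> bool" where
  "tree_le a b \<longleftrightarrow> finite a \<and> finite b \<and> prefix (sorted_list_of_set a) (sorted_list_of_set b)"

definition tree_succs :: "nat set \<Rightarrow> nat set set" where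
  "tree_succs a = {b. tree_le a b \<and> card b = card a + 1}"

definition tree_pred :: "nat set \<Rightarrow> nat set" where
  "tree_pred b = (THE a. b \<in> tree_succs a)"

definition full_tree :: "nat set set \<Rightarrow> bool" where
  "full_tree S \<longleftrightarrow>
     S \<subseteq> {a. finite a} \<and> {} \<in> S \<and>
     (\<forall>a\<in>S. infinite (tree_succs a \<inter> S)) \<and>
     (\<forall>a\<in>S. a \<noteq> {} \<longrightarrow> tree_pred a \<in> S)"

definition tree_branch :: "nat set set \<Rightarrow> (nat \<Rightarrow> nat set) \<Rightarrow> bool" where
  "tree_branch S \<beta> \<longleftrightarrow>
     range \<beta> \<subseteq> S \<and> \<beta> 0 = {} \<and> (\<forall>n. \<beta> (Suc n) \<in> tree_succs (\<beta> n))"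

lemma tree_succs_iff:
  assumes "finite a"
  shows "b \<in> tree_succs a \<longleftrightarrow> (\<exists>n. (\<forall>m\<in>a. m < n) \<and> b = insert n a)"
proof
  assume b: "b \<in> tree_succs a"
  then have fb: "finite b" and cb: "card b = card a + 1"
    and "prefix (sorted_list_of_set a) (sorted_list_of_set b)"
    by (auto simp: tree_succs_def tree_le_def)
  then obtain zs where zs: "sorted_list_of_set b = sorted_list_of_set a @ zs"
    by (auto simp: prefix_def)
  have "length zs = 1"
    using arg_cong[OF zs, of length] cb by simp
  then obtain n where n: "zs = [n]"
    by (auto simp: length_Suc_conv)
  have "set (sorted_list_of_set b) = insert n (set (sorted_list_of_set a))"
    by (simp add: zs n)
  then have eq: "b = insert n a"
    using fb assms by simp
  have "sorted (sorted_list_of_set a @ [n])" "distinct (sorted_list_of_set a @ [n])"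
    using zs n sorted_sorted_list_of_set[of b] distinct_sorted_list_of_set[of b] by simp_all
  then have "\<forall>m\<in>a. m < n"
    using assms by (auto simp: sorted_append order.strict_iff_order)
  with eq show "\<exists>n. (\<forall>m\<in>a. m < n) \<and> b = insert n a" by blast
next
  assume "\<exists>n. (\<forall>m\<in>a. m < n) \<and> b = insert n a"
  then obtain n where n: "\<forall>m\<in>a. m < n" and b: "b = insert n a" by blast
  have "n \<notin> a" using n by blast
  have "finite b" using assms b by simp
  then have "sorted_list_of_set b = sorted_list_of_set a @ [n]"
    using assms n b \<open>n \<notin> a\<close>
    by (intro sorted_distinct_set_unique sorted_sorted_list_of_set distinct_sorted_list_of_set)
      (simp_all add: sorted_append less_imp_le set_insort_key)
  then show "b \<in> tree_succs a"
    using assms b \<open>n \<notin> a\<close> by (auto simp: tree_succs_def tree_le_def)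
qed

lemma tree_pred_eq:
  assumes "finite b" "b \<noteq> {}"
  shows "tree_pred b = b - {Max b}"
  unfolding tree_pred_def
proof (rule the_equality)
  have "\<forall>m\<in>b - {Max b}. m < Max b"
    using assms by (auto simp: order.strict_iff_order)
  moreover have "b = insert (Max b) (b - {Max b})"
    using Max_in[OF assms] by blast
  ultimately show "b \<in> tree_succs (b - {Max b})"
    using assms tree_succs_iff[of "b - {Max b}" b] by blast
next
  fix a assume a: "b \<in> tree_succs a"
  then have fa: "finite a" by (simp add: tree_succs_def tree_le_def)
  with a obtain n where n: "\<forall>m\<in>a. m < n" "b = insert n a"
    using tree_succs_iff by blast
  then have "Max b = n"
    using fa by (intro Max_eqI) (auto simp: less_imp_le)
  with n show "a = b - {Max b}" by auto
qed

definition tree_separated :: "real \<Rightarrow> nat set set \<Rightarrow> (nat set \<Rightarrow> 'y::real_normed_vector) \<Rightarrow> bool" where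
  "tree_separated \<delta> S x \<longleftrightarrow>
     (\<forall>a\<in>S. \<forall>b\<in>tree_succs a \<inter> S. \<forall>b'\<in>tree_succs a \<inter> S. b \<noteq> b' \<longrightarrow> norm (x b - x b') \<ge> \<delta>)"

text \<open>A tree-assignment on \<open>S\<close> is a total function of which only the values on \<open>S\<close> are used.\<close>

definition very_strong_Schur :: "'y::banach itself \<Rightarrow> bool" where
  "very_strong_Schur _ \<longleftrightarrow>
     (\<exists>c>0. \<forall>\<delta>>0. \<forall>S. \<forall>x :: nat set \<Rightarrow> 'y.
        full_tree S \<and> bounded (x ` S) \<and> tree_separated \<delta> S x \<longrightarrow>
        (\<exists>\<beta>. tree_branch S \<beta> \<and>
           (\<exists>\<phi> :: 'y \<Rightarrow>\<^sub>L real. norm \<phi> \<le> 1 \<and>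
              (\<forall>a\<in>range \<beta>. a \<noteq> {} \<longrightarrow> \<bar>blinfun_apply \<phi> (x a)\<bar> \<ge> c * \<delta>))))"

definition finite_rank :: "('b::real_normed_vector \<Rightarrow>\<^sub>L 'b) \<Rightarrow> bool" where
  "finite_rank Q \<longleftrightarrow> (\<exists>B. finite B \<and> range (blinfun_apply Q) = span B)"

text \<open>
  Unconditional convergence is convergence of the net of finite partial sums
  (\<^const>\<open>has_sum\<close>). Some \<open>Q n\<close> may be zero, so finite decompositions are included.
\<close>

definition is_UFDD :: "(nat \<Rightarrow> 'b::banach \<Rightarrow>\<^sub>L 'b) \<Rightarrow> bool" where
  "is_UFDD Q \<longleftrightarrow>
     (\<forall>n. finite_rank (Q n) \<and> Q n o\<^sub>L Q n = Q n) \<and>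
     (\<forall>m n. m \<noteq> n \<longrightarrow> Q m o\<^sub>L Q n = 0) \<and>
     (\<forall>x. ((\<lambda>n. blinfun_apply (Q n) x) has_sum x) UNIV)"

definition has_UFDD :: "'b::banach itself \<Rightarrow> bool" where
  "has_UFDD _ \<longleftrightarrow> (\<exists>Q :: nat \<Rightarrow> 'b \<Rightarrow>\<^sub>L 'b. is_UFDD Q)"

definition isomorphic_to_subspace_of ::
    "'a::real_normed_vector itself \<Rightarrow> 'b::real_normed_vector set \<Rightarrow> bool" where
  "isomorphic_to_subspace_of _ M \<longleftrightarrow>
     (\<exists>Z. Z \<subseteq> M \<and> subspace Z \<and> closed Z \<and>
        (\<exists>(T :: 'a \<Rightarrow> 'b) T'. linear T \<and> homeomorphism UNIV Z T T'))"

text \<open>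
  As \<^typ>\<open>nat\<close> is discrete, \<^typ>\<open>nat \<Rightarrow>\<^sub>C real\<close> consists of all bounded real sequences
  with the supremum norm.
\<close>

definition c0 :: "(nat \<Rightarrow>\<^sub>C real) set" where
  "c0 = {f. apply_bcontfun f \<longlonglongrightarrow> 0}"

end

theory Submission
  imports Defs
begin

text \<open>
  Let \<open>T\<close> embed \<open>X\<close> isomorphically into the space \<open>B\<close> with decomposition \<open>(Q\<^sub>k)\<close>, and write
  \<open>R v = v \<circ> T\<close> for the restriction to \<open>X\<close> of a functional \<open>v\<close> on \<open>B\<close>. A space embeds
  into \<open>c\<^sub>0\<close> as soon as its dual contains a bounded weak*-null sequence \<open>(f\<^sub>n)\<close> with
  \<open>\<parallel>x\<parallel> \<le> M sup\<^sub>n |f\<^sub>n x|\<close>, so such a sequence is constructed.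

  The construction approximates every functional \<open>b\<close> in the unit ball of \<open>B\<^sup>*\<close> in the
  weak* sense by a chain \<open>z\<^sub>0 = 0, z\<^sub>1, z\<^sub>2, \<dots>\<close> such that \<open>z\<^sub>i\<close> comes from a
  finite set depending on \<open>i\<close> only, \<open>R (z\<^sub>i\<^sub>+\<^sub>1 - z\<^sub>i)\<close> is tiny on the first \<open>i\<close> members
  of a dense sequence of \<open>X\<close>, and the total variation \<open>\<Sum> \<parallel>R (z\<^sub>i\<^sub>+\<^sub>1 - z\<^sub>i)\<parallel>\<close> is
  bounded uniformly in \<open>b\<close>. The normalized restrictions of the increments then form the
  sequence \<open>(f\<^sub>n)\<close>. The finite sets come from weak* compactness of the dual ball, provided
  that the increments can be controlled locally: there must be a bounded potential that grows
  by about \<open>\<theta> \<parallel>R u\<parallel>\<close> whenever one passes from \<open>y\<close> to \<open>y + u\<close> with \<open>u\<close> close to \<open>0\<close> in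
  the weak* sense. Such a potential is the value of an infinite game: one player names weak*
  neighbourhoods of \<open>0\<close>, the other one (the spoiler) moves by vectors in them and tries to
  reach \<open>\<parallel>y + \<Sum> u\<^sub>i\<parallel> < r + \<theta> \<Sum> \<parallel>R u\<^sub>i\<parallel>\<close>. The value at \<open>y\<close> is the supremum
  of all \<open>r\<close> for which this fails. It is at most \<open>\<parallel>y\<parallel>\<close>, and it is bounded below on the
  ball if the spoiler cannot win from \<open>y = 0\<close>, \<open>r = -1\<close> (lemma \<open>zero_not_spoilable\<close>).

  Suppose that the spoiler did win from there. His answers form a tree of vectors \<open>v\<^sub>a\<close> for
  which the normalized restrictions \<open>R v\<^sub>a / \<parallel>R v\<^sub>a\<parallel>\<close> are \<open>1/2\<close>-separated, because
  successors are small on prescribed vectors. The very strong Schur property yields a branch and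
  a functional of norm at most \<open>1\<close> that is at least \<open>c/2\<close> in modulus on all of its normalized
  restrictions. Grouping the vectors on the branch according to the sign of the functional gives a
  set \<open>J\<close> with \<open>\<parallel>\<Sum>\<^bsub>i\<in>J\<^esub> R v\<^sub>i\<parallel> \<ge> (c/4) \<Sum> \<parallel>R v\<^sub>i\<parallel>\<close>. On the other hand the tree can
  be chosen such that the \<open>R v\<^sub>i\<close> are almost supported on disjoint blocks of the
  decomposition; so the partial sum over \<open>J\<close> is nearly the part of \<open>\<Sum> v\<^sub>i\<close> that lives on
  some of these blocks, and its norm is at most \<open>K \<parallel>\<Sum> v\<^sub>i\<parallel>\<close> up to a small error. This
  contradicts the win of the spoiler when \<open>\<theta> = c/(4K)\<close>, where \<open>K\<close> bounds the
  operators \<open>\<Sum>\<^bsub>k\<in>F\<^esub> Q\<^sub>k \<circ> T\<close> for all finite \<open>F\<close>.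

  A functional on \<open>B\<close> need not be the norm limit of its pieces \<open>\<Sum>\<^bsub>k<n\<^esub> v \<circ> Q\<^sub>k\<close>, but its
  restriction to \<open>X\<close> is (lemma \<open>piece_tail\<close>): these pieces form a weakly unconditionally Cauchy
  series in \<open>X\<^sup>*\<close>, and a non-convergent one would contain a separated sequence on which every
  functional is absolutely summable, against the very strong Schur property. This is why
  the game is played in \<open>B\<^sup>*\<close> and its steps are measured in \<open>X\<^sup>*\<close>.
\<close>

section \<open>Norming functionals\<close>

text \<open>
  Positively homogeneous and subadditive functions. The Hahn-Banach theorem is needed in the
  form that every vector is normed by a functional; it is obtained from a minimal sublinear
  function below the norm, which is automatically linear.
\<close>

definition sublinear :: "('b::real_vector \<Rightarrow> real) \<Rightarrow> bool" where
  "sublinear q \<longleftrightarrow> (\<forall>x y. q (x + y) \<le> q x + q y) \<and> (\<forall>t x. 0 \<le> t \<longrightarrow> q (t *\<^sub>R x) = t * q x)"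

lemma sublinearI:
  assumes "\<And>x y. q (x + y) \<le> q x + q y" and "q 0 = 0"
    and "\<And>t x. 0 < t \<Longrightarrow> q (t *\<^sub>R x) \<le> t * q x"
  shows "sublinear q"
proof -
  have "q (t *\<^sub>R x) = t * q x" if "0 \<le> t" for t x
  proof (cases "t = 0")
    case False
    then have t: "0 < t" using that by simp
    have "q (inverse t *\<^sub>R (t *\<^sub>R x)) \<le> inverse t * q (t *\<^sub>R x)"
      using t by (intro assms(3)) simp
    moreover have "inverse t *\<^sub>R (t *\<^sub>R x) = x"
      using t by simp
    ultimately have "q x \<le> inverse t * q (t *\<^sub>R x)"
      by (simp only:)
    then have "t * q x \<le> q (t *\<^sub>R x)"
      using t by (simp add: field_simps)
    with assms(3)[OF t, of x] show ?thesis by simp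
  qed (simp add: assms(2))
  with assms(1) show ?thesis
    by (simp add: sublinear_def)
qed

lemma sublinear_zero: "sublinear q \<Longrightarrow> q 0 = 0"
  unfolding sublinear_def by (metis mult_zero_left order_refl scale_zero_left)

lemma sublinear_ge_neg:
  assumes "sublinear q"
  shows "- q (- x) \<le> q x"
proof -
  have "q (x + - x) \<le> q x + q (- x)"
    using assms unfolding sublinear_def by blast
  then show ?thesis
    using sublinear_zero[OF assms] by simp
qed

text \<open>
  The function \<open>q' x = inf\<^sub>t\<^sub>\<ge>\<^sub>0 (q (x + t y) - t q y)\<close> is the largest sublinear function
  below \<open>q\<close> whose value at \<open>- y\<close> is at most \<open>- q y\<close>.
\<close>

lemma sublinear_reduce:
  fixes q :: "'b::real_vector \<Rightarrow> real"
  assumes q: "sublinear q"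
  obtains q' where "sublinear q'" "\<And>x. q' x \<le> q x" "q' (- y) \<le> - q y"
proof
  let ?h = "\<lambda>x t. q (x + t *\<^sub>R y) - t * q y"
  define q' where "q' x = (INF t\<in>{0..}. ?h x t)" for x
  have add: "q (a + b) \<le> q a + q b" for a b
    using q by (simp add: sublinear_def)
  have hom: "q (t *\<^sub>R a) = t * q a" if "0 \<le> t" for t a
    using q that by (simp add: sublinear_def)
  have lb: "- q (- x) \<le> ?h x t" if "0 \<le> t" for x t
    using add[of "x + t *\<^sub>R y" "- x"] hom[OF that, of y] by simp
  then have bdd: "bdd_below (?h x ` {0..})" for x
    by (auto intro!: bdd_belowI)
  have le: "q' x \<le> ?h x t" if "0 \<le> t" for x t
    unfolding q'_def using bdd that by (intro cINF_lower) auto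
  have ge: "c \<le> q' x" if "\<And>t. 0 \<le> t \<Longrightarrow> c \<le> ?h x t" for x c
    unfolding q'_def using that by (intro cINF_greatest) auto
  show "q' x \<le> q x" for x
    using le[of 0 x] by simp
  show "q' (- y) \<le> - q y"
    using le[of 1 "- y"] sublinear_zero[OF q] by simp
  show "sublinear q'"
  proof (rule sublinearI)
    fix a b
    have "q' (a + b) - ?h b s \<le> ?h a t" if "0 \<le> s" "0 \<le> t" for s t
    proof -
      have "?h (a + b) (s + t) \<le> ?h a t + ?h b s"
        using add[of "a + t *\<^sub>R y" "b + s *\<^sub>R y"] by (simp add: algebra_simps)
      with le[of "s + t" "a + b"] that show ?thesis by simp
    qed
    then have "q' (a + b) - ?h b s \<le> q' a" if "0 \<le> s" for s
      using that by (intro ge) auto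
    then have "q' (a + b) - q' a \<le> ?h b s" if "0 \<le> s" for s
      using that by (simp add: algebra_simps)
    then have "q' (a + b) - q' a \<le> q' b"
      by (rule ge)
    then show "q' (a + b) \<le> q' a + q' b" by simp
  next
    have "0 \<le> q' 0"
      by (intro ge) (simp add: hom)
    moreover have "q' 0 \<le> 0"
      using le[of 0 0] sublinear_zero[OF q] by simp
    ultimately show "q' 0 = 0" by simp
  next
    fix t :: real and x assume t: "0 < t"
    have "inverse t * q' (t *\<^sub>R x) \<le> ?h x s" if s: "0 \<le> s" for s
    proof -
      have "q' (t *\<^sub>R x) \<le> ?h (t *\<^sub>R x) (t * s)"
        using le t s by simp
      also have "\<dots> = t * ?h x s"
        using hom[of t "x + s *\<^sub>R y"] t by (simp add: algebra_simps)
      finally show ?thesis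
        using t by (simp add: field_simps)
    qed
    then have "inverse t * q' (t *\<^sub>R x) \<le> q' x"
      by (rule ge)
    then show "q' (t *\<^sub>R x) \<le> t * q' x"
      using t by (simp add: field_simps)
  qed
qed

lemma sublinear_minimal:
  fixes q0 :: "'b::real_vector \<Rightarrow> real"
  assumes q0: "sublinear q0"
  obtains m where "sublinear m" "\<And>x. m x \<le> q0 x"
    "\<And>q. sublinear q \<Longrightarrow> (\<And>x. q x \<le> m x) \<Longrightarrow> q = m"
proof -
  let ?A = "{q. sublinear q \<and> (\<forall>x. q x \<le> q0 x)}"
  let ?P = "\<lambda>p q :: 'b \<Rightarrow> real. \<forall>x. q x \<le> p x"
  have "\<exists>m\<in>?A. \<forall>q\<in>?A. ?P m q \<longrightarrow> q = m"
  proof (rule predicate_Zorn)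
    show "partial_order_on ?A (relation_of ?P ?A)"
      by (intro partial_order_on_relation_ofI) (auto intro: order_trans order_antisym intro!: ext)
    fix C assume C: "C \<in> Chains (relation_of ?P ?A)"
    then have CA: "C \<subseteq> ?A"
      by (auto simp: Chains_def relation_of_def)
    have cmp: "?P p q \<or> ?P q p" if "p \<in> C" "q \<in> C" for p q
      using C that by (auto simp: Chains_def relation_of_def)
    show "\<exists>u\<in>?A. \<forall>q\<in>C. ?P q u"
    proof (cases "C = {}")
      case False
      define u where "u x = (INF q\<in>C. q x)" for x
      have "- q0 (- x) \<le> q x" if "q \<in> C" for q x
        using sublinear_ge_neg[of q x] CA that by (force intro: order_trans[of _ "- q (- x)"])
      then have bdd: "bdd_below ((\<lambda>q. q x) ` C)" for x
        by (auto intro!: bdd_belowI)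
      have le: "u x \<le> q x" if "q \<in> C" for q x
        unfolding u_def using bdd that by (intro cINF_lower) auto
      have ge: "c \<le> u x" if "\<And>q. q \<in> C \<Longrightarrow> c \<le> q x" for x c
        unfolding u_def using that False by (intro cINF_greatest) auto
      have "sublinear u"
      proof (rule sublinearI)
        fix a b
        have "u (a + b) - p b \<le> q a" if pq: "p \<in> C" "q \<in> C" for p q
        proof -
          obtain r where r: "r \<in> C" "?P p r" "?P q r"
            using cmp[OF pq] pq by auto
          have "u (a + b) \<le> r (a + b)" by (rule le[OF r(1)])
          also have "\<dots> \<le> r a + r b"
            using r(1) CA by (auto simp: sublinear_def)
          also have "\<dots> \<le> q a + p b"
            using r by (simp add: add_mono)
          finally show ?thesis by simp
        qed
        then have "u (a + b) - p b \<le> u a" if "p \<in> C" for p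
          using that by (intro ge) auto
        then have "u (a + b) - u a \<le> p b" if "p \<in> C" for p
          using that by (simp add: algebra_simps)
        then have "u (a + b) - u a \<le> u b"
          by (rule ge)
        then show "u (a + b) \<le> u a + u b" by simp
      next
        have zero: "q 0 = 0" if "q \<in> C" for q
          using that CA sublinear_zero by auto
        then have "0 \<le> u 0"
          by (metis ge order_refl)
        moreover have "u 0 \<le> 0"
          using False le zero by (metis ex_in_conv)
        ultimately show "u 0 = 0" by simp
      next
        fix t :: real and x assume t: "0 < t"
        have "inverse t * u (t *\<^sub>R x) \<le> q x" if "q \<in> C" for q
        proof -
          have "u (t *\<^sub>R x) \<le> q (t *\<^sub>R x)" by (rule le[OF that])
          also have "\<dots> = t * q x"
            using t that CA by (auto simp: sublinear_def)
          finally show ?thesis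
            using t by (simp add: field_simps)
        qed
        then have "inverse t * u (t *\<^sub>R x) \<le> u x"
          by (rule ge)
        then show "u (t *\<^sub>R x) \<le> t * u x"
          using t by (simp add: field_simps)
      qed
      moreover have "u x \<le> q0 x" for x
        using False le CA by (force intro: order_trans)
      ultimately show ?thesis
        using le by (intro bexI[of _ u]) auto
    qed (use q0 in auto)
  qed
  then obtain m where m: "m \<in> ?A" and min: "\<And>q. q \<in> ?A \<Longrightarrow> ?P m q \<Longrightarrow> q = m"
    by blast
  show thesis
  proof (rule that)
    show "q = m" if "sublinear q" "\<And>x. q x \<le> m x" for q
      using min[of q] m that by (auto intro: order_trans)
  qed (use m in auto)
qed

lemma norming_functional:
  fixes x :: "'b::real_normed_vector"
  obtains f :: "'b \<Rightarrow>\<^sub>L real" where "norm f \<le> 1" "f x = norm x"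
proof -
  have "sublinear (norm :: 'b \<Rightarrow> real)"
    by (auto simp: sublinear_def norm_triangle_ineq)
  then obtain q where q: "sublinear q" "\<And>z. q z \<le> norm z" "q (- x) \<le> - norm x"
    using sublinear_reduce[of norm x] by metis
  obtain m where m: "sublinear m" "\<And>z. m z \<le> q z"
    and min: "\<And>p. sublinear p \<Longrightarrow> (\<And>z. p z \<le> m z) \<Longrightarrow> p = m"
    using sublinear_minimal[OF q(1)] by metis
  have odd: "m (- y) = - m y" for y
  proof -
    \<comment> \<open>Minimality of \<open>m\<close> forces every reduction of \<open>m\<close> to be \<open>m\<close> itself.\<close>
    obtain p where p: "sublinear p" "\<And>z. p z \<le> m z" "p (- y) \<le> - m y"
      using sublinear_reduce[OF m(1), of y] by metis
    then have "m (- y) \<le> - m y"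
      using min by metis
    then show ?thesis
      using sublinear_ge_neg[OF m(1), of y] by simp
  qed
  have sub: "m (a + b) \<le> m a + m b" for a b
    using m(1) by (simp add: sublinear_def)
  have add: "m (a + b) = m a + m b" for a b
    using sub[of a b] sub[of "- a" "- b"] odd[of "a + b"] odd[of a] odd[of b] by simp
  have scale: "m (t *\<^sub>R a) = t * m a" for t a
  proof (cases "0 \<le> t")
    case True
    then show ?thesis using m(1) by (simp add: sublinear_def)
  next
    case False
    then have "m ((- t) *\<^sub>R a) = (- t) * m a"
      using m(1) by (simp add: sublinear_def del: scaleR_minus_left)
    then show ?thesis
      using odd[of "t *\<^sub>R a"] by simp
  qed
  have le: "m z \<le> norm z" for z
    using m(2) q(2) order_trans by blast
  have abs: "\<bar>m z\<bar> \<le> norm z" for z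
    using le[of z] le[of "- z"] odd[of z] by simp
  then have "bounded_linear m"
    by (intro bounded_linear_intro[where K = 1]) (simp_all add: add scale)
  then have ap: "blinfun_apply (Blinfun m) = m"
    by (rule bounded_linear_Blinfun_apply)
  show thesis
  proof
    show "norm (Blinfun m) \<le> 1"
      by (rule norm_blinfun_bound) (simp_all add: ap abs)
    have "norm x \<le> m x"
      using q(3) m(2)[of "- x"] odd[of x] by simp
    then show "Blinfun m x = norm x"
      using le[of x] ap by simp
  qed
qed

section \<open>Uniform boundedness, weak* compactness and finite-dimensional spans\<close>

text \<open>
  The uniform boundedness principle; the index set \<open>I\<close> is arbitrary.
\<close>

lemma banach_steinhaus:
  fixes f :: "'i \<Rightarrow> 'a::banach \<Rightarrow>\<^sub>L 'b::real_normed_vector"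
  assumes pt: "\<And>x. \<exists>M. \<forall>i\<in>I. norm (f i x) \<le> M"
  obtains M where "0 < M" "\<And>i. i \<in> I \<Longrightarrow> norm (f i) \<le> M"
proof -
  define C where "C n = {x. \<forall>i\<in>I. norm (f i x) \<le> real n}" for n
  have closed: "closed (C n)" for n
    unfolding C_def Collect_ball_eq
    by (intro closed_INT ballI closed_Collect_le continuous_intros)
  have un: "\<Union>(range C) = UNIV"
  proof -
    have "\<exists>n. x \<in> C n" for x
    proof -
      obtain M where M: "\<forall>i\<in>I. norm (f i x) \<le> M" using pt by blast
      obtain n where "M \<le> real n" using real_arch_simple by blast
      then show ?thesis
        using M by (intro exI[of _ n]) (auto simp: C_def intro: order_trans)
    qed
    then show ?thesis by auto
  qed
  \<comment> \<open>Baire category: the closed sets \<open>C n\<close> exhaust a complete space.\<close>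
  have "\<exists>n. interior (C n) \<noteq> {}"
  proof (rule ccontr)
    assume "\<not> ?thesis"
    then have "euclidean interior_of \<Union>(range C) = {}"
      using closed
      by (intro Baire_category_alt) (auto simp: completely_metrizable_space_euclidean)
    then show False using un by simp
  qed
  then obtain n z where "z \<in> interior (C n)" by blast
  then obtain e where e: "0 < e" "cball z e \<subseteq> C n"
    by (meson mem_interior_cball)
  show thesis
  proof
    show "0 < 2 * real n / e + 1" using e(1) by (simp add: add_nonneg_pos)
    fix i assume i: "i \<in> I"
    have "norm (f i) \<le> 2 * real n / e"
    proof (rule norm_blinfun_bound)
      show "0 \<le> 2 * real n / e" using e(1) by simp
      fix x
      show "norm (f i x) \<le> 2 * real n / e * norm x"
      proof (cases "x = 0")
        case False
        define y where "y = (e / norm x) *\<^sub>R x"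
        have "norm y = e" using e(1) False by (simp add: y_def)
        then have "z + y \<in> C n" "z \<in> C n"
          using e by (auto intro!: subsetD[OF e(2)] simp: dist_norm)
        then have "norm (f i (z + y)) \<le> n" "norm (f i z) \<le> n"
          using i by (auto simp: C_def)
        then have "norm (f i (z + y) - f i z) \<le> 2 * real n"
          using norm_triangle_ineq4[of "f i (z + y)" "f i z"] by simp
        then have "norm (f i y) \<le> 2 * real n"
          by (simp add: blinfun.add_right)
        then have "e / norm x * norm (f i x) \<le> 2 * real n"
          using e(1) by (simp add: y_def blinfun.scaleR_right)
        then show ?thesis
          using e(1) False by (simp add: field_simps)
      qed simp
    qed
    then show "norm (f i) \<le> 2 * real n / e + 1" by simp
  qed
qed

text \<open>
  The Banach-Alaoglu theorem: on the dual unit ball the weak* topology is the topology of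
  pointwise convergence, here the product topology on functions.
\<close>

lemma compact_dual_ball:
  "compact {blinfun_apply y |y :: 'b::real_normed_vector \<Rightarrow>\<^sub>L real. norm y \<le> 1}" (is "compact ?K")
proof -
  let ?P = "\<Pi>\<^sub>E x\<in>(UNIV :: 'b set). {- norm x..norm x}"
  have "compactin (product_topology (\<lambda>i::'b. euclidean) UNIV) ?P"
    by (subst compactin_PiE) (simp add: compactin_euclidean_iff)
  then have "compact ?P"
    by (simp add: euclidean_product_topology compactin_euclidean_iff)
  let ?L = "{g :: 'b \<Rightarrow> real. (\<forall>x y. g (x + y) = g x + g y) \<and> (\<forall>t x. g (t *\<^sub>R x) = t * g x)}"
  have "closed ?L"
    unfolding Collect_conj_eq Collect_all_eq
    by (intro closed_Int closed_INT ballI closed_Collect_eq continuous_intros) simp_all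
  with \<open>compact ?P\<close> have "compact (?P \<inter> ?L)" by blast
  moreover have "?P \<inter> ?L = ?K"
  proof (intro equalityI subsetI)
    fix g assume g: "g \<in> ?P \<inter> ?L"
    then have le: "\<bar>g x\<bar> \<le> norm x" for x
      by (auto simp: PiE_iff abs_le_iff minus_le_iff)
    then have "bounded_linear g"
      using g by (intro bounded_linear_intro[where K = 1]) auto
    then have ap: "blinfun_apply (Blinfun g) = g"
      by (rule bounded_linear_Blinfun_apply)
    have "norm (Blinfun g) \<le> 1"
      by (rule norm_blinfun_bound) (simp_all add: ap le)
    with ap show "g \<in> ?K" by force
  next
    fix g assume "g \<in> ?K"
    then obtain y :: "'b \<Rightarrow>\<^sub>L real" where y: "g = blinfun_apply y" "norm y \<le> 1" by blast
    have "\<bar>y x\<bar> \<le> norm x" for x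
      using norm_blinfun[of y x] mult_right_mono[OF y(2), of "norm x"] by simp
    then show "g \<in> ?P \<inter> ?L"
      by (auto simp: PiE_iff y abs_le_iff minus_le_iff blinfun.add_right blinfun.scaleR_right)
  qed
  ultimately show ?thesis by simp
qed

text \<open>
  Vectors in the span of a finite set have coordinates that are bounded by a multiple of the
  norm. In the induction step, coordinates in a box form a compact set; so the span
  of \<open>B\<close> has positive distance from a vector outside of it.
\<close>

lemma finite_span_coordinates:
  fixes B :: "'b::real_normed_vector set"
  assumes "finite B"
  shows "\<exists>M\<ge>0. \<forall>x\<in>span B. \<exists>c. x = (\<Sum>b\<in>B. c b *\<^sub>R b) \<and> (\<forall>b\<in>B. \<bar>c b\<bar> \<le> M * norm x)"
  using assms
proof (induction B)
  case empty
  then show ?case by (intro exI[of _ 0]) simp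
next
  case (insert b B)
  then obtain M where M: "0 \<le> M"
    and coord: "\<And>x. x \<in> span B \<Longrightarrow> \<exists>c. x = (\<Sum>b\<in>B. c b *\<^sub>R b) \<and> (\<forall>b\<in>B. \<bar>c b\<bar> \<le> M * norm x)"
    by blast
  show ?case
  proof (cases "b \<in> span B")
    case True
    have "\<exists>c. x = (\<Sum>b\<in>insert b B. c b *\<^sub>R b) \<and> (\<forall>b\<in>insert b B. \<bar>c b\<bar> \<le> M * norm x)"
      if "x \<in> span (insert b B)" for x
    proof -
      have "x \<in> span B" using that True by (simp add: span_redundant)
      then obtain c where c: "x = (\<Sum>b\<in>B. c b *\<^sub>R b)" "\<forall>b\<in>B. \<bar>c b\<bar> \<le> M * norm x"
        using coord by blast
      have "(\<Sum>a\<in>insert b B. (c(b := 0)) a *\<^sub>R a) = (\<Sum>a\<in>B. c a *\<^sub>R a)"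
        using insert.hyps by (simp, intro sum.cong) auto
      then show ?thesis
        using c M by (intro exI[of _ "c(b := 0)"]) auto
    qed
    with M show ?thesis by blast
  next
    case False
    define S where "S = (\<lambda>c. \<Sum>a\<in>B. c a *\<^sub>R a) `
      (\<Pi>\<^sub>E a\<in>UNIV. {- (M * (norm b + 1))..M * (norm b + 1)})"
    have "compactin (product_topology (\<lambda>a::'b. euclidean) UNIV)
        (\<Pi>\<^sub>E a\<in>UNIV. {- (M * (norm b + 1))..M * (norm b + 1)})"
      by (subst compactin_PiE) (simp add: compactin_euclidean_iff)
    then have "compact S"
      unfolding S_def euclidean_product_topology compactin_euclidean_iff
      by (intro compact_continuous_image continuous_intros
          continuous_on_subset[OF continuous_on_product_coordinates]) auto
    then have "closed S" by (rule compact_imp_closed)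
    have "S \<subseteq> span B"
      by (auto simp: S_def intro: span_sum span_scale span_base)
    then have "b \<notin> S" using False by blast
    then obtain d' where d': "0 < d'" "\<And>y. y \<in> S \<Longrightarrow> d' \<le> dist b y"
      using \<open>closed S\<close> unfolding closed_def open_dist
      by (metis ComplI ComplD dist_commute linorder_not_less)
    define d where "d = min d' 1"
    have d: "0 < d" using d'(1) by (simp add: d_def)
    have dist: "d \<le> norm (b - y)" if y: "y \<in> span B" for y
    proof (cases "norm y \<le> norm b + 1")
      case True
      obtain c where c: "y = (\<Sum>b\<in>B. c b *\<^sub>R b)" "\<forall>a\<in>B. \<bar>c a\<bar> \<le> M * norm y"
        using coord[OF y] by blast
      define c' where "c' a = (if a \<in> B then c a else 0)" for a
      have "\<bar>c' a\<bar> \<le> M * (norm b + 1)" for a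
        using c(2) M mult_left_mono[OF True M] by (force simp: c'_def)
      then have "c' \<in> (\<Pi>\<^sub>E a\<in>UNIV. {- (M * (norm b + 1))..M * (norm b + 1)})"
        by (auto simp: PiE_iff abs_le_iff minus_le_iff)
      moreover have "y = (\<Sum>a\<in>B. c' a *\<^sub>R a)"
        using c(1) by (simp add: c'_def)
      ultimately have "y \<in> S" unfolding S_def by blast
      then show ?thesis
        using d'(2) by (force simp: d_def dist_norm)
    next
      case False
      then show ?thesis
        using norm_triangle_ineq2[of y b] by (simp add: d_def norm_minus_commute)
    qed
    define M' where "M' = max (1 / d) (M * (1 + norm b / d))"
    have "\<exists>c. x = (\<Sum>a\<in>insert b B. c a *\<^sub>R a) \<and> (\<forall>a\<in>insert b B. \<bar>c a\<bar> \<le> M' * norm x)"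
      if "x \<in> span (insert b B)" for x
    proof -
      obtain k where k: "x - k *\<^sub>R b \<in> span B"
        using \<open>x \<in> span (insert b B)\<close> span_breakdown_eq by blast
      have kle: "\<bar>k\<bar> \<le> norm x / d"
      proof (cases "k = 0")
        case False
        have "(- inverse k) *\<^sub>R (x - k *\<^sub>R b) \<in> span B"
          using k by (rule span_scale)
        then have "d \<le> norm (b - (- inverse k) *\<^sub>R (x - k *\<^sub>R b))"
          by (rule dist)
        also have "b - (- inverse k) *\<^sub>R (x - k *\<^sub>R b) = inverse k *\<^sub>R x"
          using False by (simp add: algebra_simps)
        finally have "d \<le> norm x / \<bar>k\<bar>"
          by (simp add: divide_inverse mult.commute)
        then show ?thesis
          using d False by (simp add: field_simps)
      qed (use d in simp)
      obtain c where c: "x - k *\<^sub>R b = (\<Sum>a\<in>B. c a *\<^sub>R a)"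
        "\<forall>a\<in>B. \<bar>c a\<bar> \<le> M * norm (x - k *\<^sub>R b)"
        using coord[OF k] by blast
      have "norm (x - k *\<^sub>R b) \<le> norm x + \<bar>k\<bar> * norm b"
        using norm_triangle_ineq4[of x "k *\<^sub>R b"] by simp
      also have "\<dots> \<le> norm x + norm x / d * norm b"
        using kle by (intro add_left_mono mult_right_mono) auto
      also have "\<dots> = (1 + norm b / d) * norm x"
        by (simp add: algebra_simps)
      finally have "M * norm (x - k *\<^sub>R b) \<le> M * (1 + norm b / d) * norm x"
        using M by (simp add: mult.assoc mult_left_mono)
      also have "\<dots> \<le> M' * norm x"
        by (intro mult_right_mono) (auto simp: M'_def)
      finally have 1: "\<bar>c a\<bar> \<le> M' * norm x" if "a \<in> B" for a
        using c(2) that by force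
      have "norm x / d \<le> M' * norm x"
        using mult_right_mono[of "1 / d" M' "norm x"] by (simp add: M'_def)
      with kle have 2: "\<bar>k\<bar> \<le> M' * norm x" by simp
      have "(\<Sum>a\<in>insert b B. (c(b := k)) a *\<^sub>R a) = k *\<^sub>R b + (\<Sum>a\<in>B. c a *\<^sub>R a)"
        using insert.hyps by (simp, intro sum.cong) auto
      also have "\<dots> = x" using c(1) by (simp add: algebra_simps)
      finally show ?thesis
        using 1 2 by (intro exI[of _ "c(b := k)"]) auto
    qed
    moreover have "0 \<le> M'" using d by (simp add: M'_def le_max_iff_disj)
    ultimately show ?thesis by blast
  qed
qed

text \<open>
  A consequence is that a functional that is small at finitely many points is
  small in norm after composition with \<open>Q\<close>.
\<close>

lemma finite_rank_comp_bound:
  fixes Q :: "'b::real_normed_vector \<Rightarrow>\<^sub>L 'b"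
  assumes "finite_rank Q"
  obtains D E where "0 \<le> D" "finite E"
    "\<And>v :: 'b \<Rightarrow>\<^sub>L real. norm (v o\<^sub>L Q) \<le> D * (\<Sum>e\<in>E. \<bar>v e\<bar>)"
proof -
  obtain E where E: "finite E" "range Q = span E"
    using assms by (auto simp: finite_rank_def)
  obtain M where M: "0 \<le> M"
    and coord: "\<And>x. x \<in> span E \<Longrightarrow> \<exists>c. x = (\<Sum>b\<in>E. c b *\<^sub>R b) \<and> (\<forall>b\<in>E. \<bar>c b\<bar> \<le> M * norm x)"
    using finite_span_coordinates[OF E(1)] by blast
  show thesis
  proof
    show "0 \<le> M * norm Q" using M by simp
    show "finite E" by fact
    fix v :: "'b \<Rightarrow>\<^sub>L real"
    show "norm (v o\<^sub>L Q) \<le> M * norm Q * (\<Sum>e\<in>E. \<bar>v e\<bar>)"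
    proof (rule norm_blinfun_bound)
      show "0 \<le> M * norm Q * (\<Sum>e\<in>E. \<bar>v e\<bar>)"
        using M by (simp add: sum_nonneg)
      fix x
      obtain c where c: "Q x = (\<Sum>b\<in>E. c b *\<^sub>R b)" "\<forall>b\<in>E. \<bar>c b\<bar> \<le> M * norm (Q x)"
        using coord[of "Q x"] E(2) by blast
      have "\<bar>v (Q x)\<bar> = \<bar>\<Sum>b\<in>E. c b * v b\<bar>"
        by (simp add: c(1) blinfun.sum_right blinfun.scaleR_right)
      also have "\<dots> \<le> (\<Sum>b\<in>E. \<bar>c b\<bar> * \<bar>v b\<bar>)"
        using sum_abs[of "\<lambda>b. c b * v b" E] by (simp add: abs_mult)
      also have "\<dots> \<le> (\<Sum>b\<in>E. (M * norm (Q x)) * \<bar>v b\<bar>)"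
        using c(2) by (intro sum_mono mult_right_mono) auto
      also have "\<dots> = M * norm (Q x) * (\<Sum>b\<in>E. \<bar>v b\<bar>)"
        by (simp add: sum_distrib_left)
      also have "\<dots> \<le> M * (norm Q * norm x) * (\<Sum>b\<in>E. \<bar>v b\<bar>)"
        using M by (intro mult_right_mono mult_left_mono norm_blinfun sum_nonneg) auto
      finally show "norm ((v o\<^sub>L Q) x) \<le> M * norm Q * (\<Sum>e\<in>E. \<bar>v e\<bar>) * norm x"
        by (simp add: ac_simps)
    qed
  qed
qed

lemma norm_blinfun_witness:
  fixes f :: "'a::real_normed_vector \<Rightarrow>\<^sub>L real"
  assumes "d < norm f" "0 \<le> d"
  obtains x where "norm x \<le> 1" "d < f x"
proof -
  have "\<exists>x. norm x \<le> 1 \<and> d < \<bar>f x\<bar>"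
  proof (rule ccontr)
    assume "\<not> ?thesis"
    then have le: "\<bar>f x\<bar> \<le> d" if "norm x \<le> 1" for x
      using that by force
    have "norm f \<le> d"
    proof (rule norm_blinfun_bound[OF assms(2)])
      fix x
      show "norm (f x) \<le> d * norm x"
      proof (cases "x = 0")
        case False
        then have "\<bar>f (inverse (norm x) *\<^sub>R x)\<bar> \<le> d" by (intro le) simp
        then show ?thesis
          using False by (simp add: blinfun.scaleR_right abs_mult field_simps)
      qed simp
    qed
    with assms(1) show False by simp
  qed
  then obtain x where x: "norm x \<le> 1" "d < \<bar>f x\<bar>" by blast
  show thesis
  proof (cases "0 \<le> f x")
    case True
    then show thesis using that[of x] x by simp
  next
    case False
    then show thesis using that[of "- x"] x by (simp add: blinfun.minus_right)
  qed
qed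

lemma sum_abs_le_twice:
  fixes a :: "'i \<Rightarrow> real"
  assumes A: "finite A" and le: "\<And>J. J \<subseteq> A \<Longrightarrow> \<bar>\<Sum>i\<in>J. a i\<bar> \<le> b"
  shows "(\<Sum>i\<in>A. \<bar>a i\<bar>) \<le> 2 * b"
proof -
  define P where "P = {i\<in>A. 0 \<le> a i}"
  have "(\<Sum>i\<in>A. \<bar>a i\<bar>) = (\<Sum>i\<in>A - P. \<bar>a i\<bar>) + (\<Sum>i\<in>P. \<bar>a i\<bar>)"
    by (rule sum.subset_diff) (use A in \<open>auto simp: P_def\<close>)
  also have "(\<Sum>i\<in>A - P. \<bar>a i\<bar>) = - (\<Sum>i\<in>A - P. a i)"
    unfolding sum_negf[symmetric] by (rule sum.cong) (auto simp: P_def)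
  also have "(\<Sum>i\<in>P. \<bar>a i\<bar>) = (\<Sum>i\<in>P. a i)"
    by (rule sum.cong) (auto simp: P_def)
  finally show ?thesis
    using le[of P] le[of "A - P"] by (auto simp: P_def)
qed

lemma dense_sequence:
  assumes "separable_space (euclidean :: 'a::real_normed_vector topology)"
  obtains d :: "nat \<Rightarrow> 'a::real_normed_vector" where "\<And>x e. 0 < e \<Longrightarrow> \<exists>j. norm (x - d j) < e"
proof -
  obtain D :: "'a set" where D: "countable D" "closure D = UNIV"
    using assms unfolding separable_space_def by auto
  then have "D \<noteq> {}" by auto
  show thesis
  proof
    fix x :: 'a and e :: real assume "0 < e"
    then obtain y where "y \<in> D" "dist y x < e"
      using D(2) closure_approachable by (metis UNIV_I)
    then show "\<exists>j. norm (x - from_nat_into D j) < e"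
      using D(1) from_nat_into_surj[of D y] by (metis dist_commute dist_norm)
  qed
qed

lemma linear_homeomorphism_bounds:
  fixes T :: "'a::real_normed_vector \<Rightarrow> 'b::real_normed_vector"
  assumes lin: "linear T" and hom: "homeomorphism UNIV Z T T'"
  shows "bounded_linear T" and "\<exists>b. \<forall>x. norm x \<le> b * norm (T x)"
proof -
  interpret linear T by fact
  have cT: "continuous_on UNIV T" and cT': "continuous_on Z T'" and inv: "T' (T x) = x"
    and TZ: "T x \<in> Z" for x
    using hom by (auto simp: homeomorphism_def)
  have "T' 0 = 0" using inv[of 0] zero by simp
  have "0 \<in> Z" using TZ[of 0] zero by simp
  obtain d where d: "0 < d" "\<And>x. norm x < d \<Longrightarrow> norm (T x) < 1"
    using cT[unfolded continuous_on_iff, rule_format, of 0 1] zero by auto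
  show "bounded_linear T"
  proof (rule bounded_linear_intro[where K = "2 / d"])
    fix x
    show "norm (T x) \<le> norm x * (2 / d)"
    proof (cases "x = 0")
      case False
      have "norm (T ((d / (2 * norm x)) *\<^sub>R x)) < 1"
        using d(1) False by (intro d(2)) simp
      then show ?thesis
        using d(1) False by (simp add: scale field_simps)
    qed (simp add: zero)
  qed (simp_all add: add scale)
  obtain c where c: "0 < c" "\<And>z. z \<in> Z \<Longrightarrow> norm z < c \<Longrightarrow> norm (T' z) < 1"
    using cT'[unfolded continuous_on_iff, rule_format, of 0 1] \<open>0 \<in> Z\<close> \<open>T' 0 = 0\<close> by auto
  have "norm x \<le> 2 / c * norm (T x)" for x
  proof (cases "T x = 0")
    case True
    then show ?thesis using inv[of x] \<open>T' 0 = 0\<close> by simp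
  next
    case False
    let ?y = "(c / (2 * norm (T x))) *\<^sub>R x"
    have "norm (T ?y) < c"
      using c(1) False by (simp add: scale)
    then have "norm (T' (T ?y)) < 1"
      by (rule c(2)[OF TZ])
    then have "norm ?y < 1" by (simp only: inv)
    then show ?thesis
      using c(1) False by (simp add: field_simps)
  qed
  then show "\<exists>b. \<forall>x. norm x \<le> b * norm (T x)" by blast
qed

lemma bounded_partial_sums_if_has_sum:
  fixes g :: "nat \<Rightarrow> 'b::real_normed_vector"
  assumes "(g has_sum y) UNIV"
  shows "\<exists>M. \<forall>F. finite F \<longrightarrow> norm (\<Sum>k\<in>F. g k) \<le> M"
proof -
  have "\<forall>\<^sub>F F in finite_subsets_at_top UNIV. dist (\<Sum>k\<in>F. g k) y < 1"
    using assms unfolding has_sum_def tendsto_iff by (metis zero_less_one)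
  then obtain G where G: "finite G"
    "\<And>F. finite F \<Longrightarrow> G \<subseteq> F \<Longrightarrow> dist (\<Sum>k\<in>F. g k) y < 1"
    unfolding eventually_finite_subsets_at_top by auto
  have "norm (\<Sum>k\<in>F. g k) \<le> 1 + norm y + (\<Sum>k\<in>G. norm (g k))" if F: "finite F" for F
  proof -
    have "(\<Sum>k\<in>F. g k) = ((\<Sum>k\<in>F \<union> G. g k) - y) + y - (\<Sum>k\<in>G - F. g k)"
      using sum.union_disjoint[of F "G - F" g] F G(1) by simp
    also have "norm \<dots> \<le> norm ((\<Sum>k\<in>F \<union> G. g k) - y) + norm y + norm (\<Sum>k\<in>G - F. g k)"
      by (intro order_trans[OF norm_triangle_ineq4] add_right_mono norm_triangle_ineq)
    also have "\<dots> \<le> 1 + norm y + (\<Sum>k\<in>G. norm (g k))"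
    proof (intro add_mono order_refl)
      show "norm ((\<Sum>k\<in>F \<union> G. g k) - y) \<le> 1"
        using G(2)[of "F \<union> G"] F G(1) by (simp add: dist_norm)
      have "norm (\<Sum>k\<in>G - F. g k) \<le> (\<Sum>k\<in>G - F. norm (g k))"
        by (rule norm_sum)
      also have "\<dots> \<le> (\<Sum>k\<in>G. norm (g k))"
        using G(1) by (intro sum_mono2) auto
      finally show "norm (\<Sum>k\<in>G - F. g k) \<le> (\<Sum>k\<in>G. norm (g k))" .
    qed
    finally show ?thesis .
  qed
  then show ?thesis by blast
qed

section \<open>Separated trees indexed by lists\<close>

lemma sorted_list_tree_succs:
  assumes "b \<in> tree_succs a"
  obtains n where "sorted_list_of_set b = sorted_list_of_set a @ [n]"
proof -
  from assms have "prefix (sorted_list_of_set a) (sorted_list_of_set b)" "card b = card a + 1"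
    by (auto simp: tree_succs_def tree_le_def)
  then obtain zs where zs: "sorted_list_of_set b = sorted_list_of_set a @ zs"
    by (auto simp: prefix_def)
  have "length zs = 1"
    using arg_cong[OF zs, of length] \<open>card b = card a + 1\<close> by simp
  then show thesis
    using zs that by (auto simp: length_Suc_conv)
qed

lemma full_tree_finite_sets: "full_tree {a :: nat set. finite a}"
  unfolding full_tree_def
proof (intro conjI ballI impI)
  fix a :: "nat set" assume "a \<in> {a. finite a}"
  then have a: "finite a" by simp
  define N where "N = Suc (Max (insert 0 a))"
  have N: "m < n" if "m \<in> a" "N \<le> n" for m n
  proof -
    have "m \<le> Max (insert 0 a)"
      using a that by (intro Max_ge) auto
    then show ?thesis
      using that unfolding N_def by linarith
  qed
  have "insert n a \<in> tree_succs a" if "N \<le> n" for n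
    unfolding tree_succs_iff[OF a] using N that by blast
  then have "(\<lambda>n. insert n a) ` {N..} \<subseteq> tree_succs a \<inter> {a. finite a}"
    using a by auto
  moreover have "inj_on (\<lambda>n. insert n a) {N..}"
    using N by (intro inj_onI) (metis atLeast_iff insert_iff less_irrefl)
  then have "infinite ((\<lambda>n. insert n a) ` {N..})"
    using finite_imageD infinite_Ici by blast
  ultimately show "infinite (tree_succs a \<inter> {a. finite a})"
    using finite_subset by blast
next
  fix a :: "nat set" assume "a \<in> {a. finite a}" "a \<noteq> {}"
  then show "tree_pred a \<in> {a. finite a}"
    using tree_pred_eq by simp
qed auto

text \<open>
  The very strong Schur property for trees indexed by all lists of natural numbers. Finite
  sets correspond to increasing lists; hence the branches obtained are strictly increasing
  sequences, although the family is defined and separated on all lists.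
\<close>

lemma very_strong_Schur_lists:
  assumes "very_strong_Schur TYPE('y::banach)"
  obtains c where "0 < c"
    "\<And>(x :: nat list \<Rightarrow> 'y) M d. \<lbrakk>0 < d; \<And>l. norm (x l) \<le> M;
        \<And>l n m. n \<noteq> m \<Longrightarrow> d \<le> norm (x (l @ [n]) - x (l @ [m]))\<rbrakk> \<Longrightarrow>
      \<exists>s. strict_mono s \<and> (\<exists>\<phi> :: 'y \<Rightarrow>\<^sub>L real. norm \<phi> \<le> 1 \<and>
        (\<forall>n. c * d \<le> \<bar>blinfun_apply \<phi> (x (map s [0..<Suc n]))\<bar>))"
proof -
  obtain c where c: "0 < c" and
    schur: "\<forall>d>0. \<forall>S. \<forall>x :: nat set \<Rightarrow> 'y.
        full_tree S \<and> bounded (x ` S) \<and> tree_separated d S x \<longrightarrow>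
        (\<exists>\<beta>. tree_branch S \<beta> \<and> (\<exists>\<phi> :: 'y \<Rightarrow>\<^sub>L real. norm \<phi> \<le> 1 \<and>
              (\<forall>a\<in>range \<beta>. a \<noteq> {} \<longrightarrow> \<bar>blinfun_apply \<phi> (x a)\<bar> \<ge> c * d)))"
    using assms unfolding very_strong_Schur_def by (elim exE conjE)
  show thesis
  proof (rule that[OF c])
    fix x :: "nat list \<Rightarrow> 'y" and M d :: real
    assume d: "0 < d" and M: "\<And>l. norm (x l) \<le> M"
      and sep: "\<And>l n m. n \<noteq> m \<Longrightarrow> d \<le> norm (x (l @ [n]) - x (l @ [m]))"
    define y where "y a = x (sorted_list_of_set a)" for a
    have "tree_separated d {a. finite a} y"
      unfolding tree_separated_def
    proof (intro ballI impI)
      fix a b b' assume b: "b \<in> tree_succs a \<inter> {a. finite a}" "b' \<in> tree_succs a \<inter> {a. finite a}"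
        and ne: "b \<noteq> b'"
      obtain n m where nm: "sorted_list_of_set b = sorted_list_of_set a @ [n]"
        "sorted_list_of_set b' = sorted_list_of_set a @ [m]"
        using b sorted_list_tree_succs by (metis IntD1)
      have "n \<noteq> m"
        using ne nm b sorted_list_of_set_inject[of b b'] by auto
      then show "d \<le> norm (y b - y b')"
        unfolding y_def nm by (rule sep)
    qed
    moreover have "bounded (y ` {a. finite a})"
      using M by (auto simp: bounded_iff y_def)
    ultimately have "\<exists>\<beta>. tree_branch {a. finite a} \<beta> \<and> (\<exists>\<phi> :: 'y \<Rightarrow>\<^sub>L real. norm \<phi> \<le> 1 \<and>
              (\<forall>a\<in>range \<beta>. a \<noteq> {} \<longrightarrow> \<bar>blinfun_apply \<phi> (y a)\<bar> \<ge> c * d))"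
      using schur d full_tree_finite_sets by simp
    then obtain \<beta> and \<phi> :: "'y \<Rightarrow>\<^sub>L real" where \<beta>: "tree_branch {a. finite a} \<beta>"
      and \<phi>: "norm \<phi> \<le> 1" "\<And>n. \<beta> n \<noteq> {} \<Longrightarrow> c * d \<le> \<bar>blinfun_apply \<phi> (y (\<beta> n))\<bar>"
      by (metis rangeI)
    define s where "s n = last (sorted_list_of_set (\<beta> (Suc n)))" for n
    have step: "sorted_list_of_set (\<beta> (Suc n)) = sorted_list_of_set (\<beta> n) @ [s n]" for n
      using \<beta> sorted_list_tree_succs[of "\<beta> (Suc n)" "\<beta> n"]
      unfolding s_def tree_branch_def by (metis last_snoc)
    have list: "sorted_list_of_set (\<beta> n) = map s [0..<n]" for n
      by (induction n) (use \<beta> step in \<open>auto simp: tree_branch_def\<close>)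
    have "strict_mono s"
    proof (rule strict_mono_Suc_iff[THEN iffD2], intro allI)
      fix n
      have "sorted (map s [0..<Suc (Suc n)])" "distinct (map s [0..<Suc (Suc n)])"
        by (simp_all only: list[symmetric] sorted_sorted_list_of_set distinct_sorted_list_of_set)
      then show "s n < s (Suc n)"
        by (auto simp: sorted_append order.strict_iff_order)
    qed
    moreover have "c * d \<le> \<bar>blinfun_apply \<phi> (x (map s [0..<Suc n]))\<bar>" for n
    proof -
      have "sorted_list_of_set (\<beta> (Suc n)) \<noteq> []"
        by (simp add: step)
      then have "\<beta> (Suc n) \<noteq> {}"
        by auto
      then show ?thesis
        using \<phi>(2)[of "Suc n"] unfolding y_def list by blast
    qed
    ultimately show "\<exists>s. strict_mono s \<and> (\<exists>\<phi> :: 'y \<Rightarrow>\<^sub>L real. norm \<phi> \<le> 1 \<and>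
        (\<forall>n. c * d \<le> \<bar>blinfun_apply \<phi> (x (map s [0..<Suc n]))\<bar>))"
      using \<phi>(1) by blast
  qed
qed

text \<open>
  The tree whose nodes of length one carry \<open>u k\<close>, above which the tree \<open>W k\<close> without its
  root is placed. The value at the empty list is irrelevant.
\<close>

definition graft :: "(nat \<Rightarrow> 'c) \<Rightarrow> (nat \<Rightarrow> nat list \<Rightarrow> 'c) \<Rightarrow> nat list \<Rightarrow> 'c" where
  "graft u W l = (case l of [] \<Rightarrow> u 0 | k # l' \<Rightarrow> if l' = [] then u k else W k l')"

lemma graft_branch:
  "(\<lambda>i. graft u W (map s [0..<Suc i])) =
    case_nat (u (s 0)) (\<lambda>i. W (s 0) (map (s \<circ> Suc) [0..<Suc i]))"
proof
  fix i
  have "map s [0..<Suc i] = s 0 # map (s \<circ> Suc) [0..<i]"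
    by (simp only: upt_conv_Cons[OF zero_less_Suc] map_Suc_upt[symmetric] list.map map_map)
  then show "graft u W (map s [0..<Suc i]) =
      case_nat (u (s 0)) (\<lambda>i. W (s 0) (map (s \<circ> Suc) [0..<Suc i])) i"
    by (cases i) (simp_all add: graft_def del: upt_Suc)
qed

section \<open>Pieces of functionals under an unconditional decomposition\<close>

text \<open>
  Basic weak* neighbourhoods of \<open>0\<close> in the dual. The bound is always \<open>1\<close>; smaller bounds
  are obtained by scaling the members of \<open>E\<close>.
\<close>

definition weak_star_nbhd :: "'b::real_normed_vector set \<Rightarrow> ('b \<Rightarrow>\<^sub>L real) set" where
  "weak_star_nbhd E = {v. \<forall>e\<in>E. \<bar>blinfun_apply v e\<bar> < 1}"

lemma weak_star_nbhd_Un: "weak_star_nbhd (E \<union> E') = weak_star_nbhd E \<inter> weak_star_nbhd E'"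
  by (auto simp: weak_star_nbhd_def)

lemma weak_star_nbhd_scaled:
  assumes "0 < s"
  shows "v \<in> weak_star_nbhd ((\<lambda>e. s *\<^sub>R e) ` E) \<longleftrightarrow> (\<forall>e\<in>E. \<bar>v e\<bar> < 1 / s)"
  using assms by (simp add: weak_star_nbhd_def blinfun.scaleR_right abs_mult field_simps)

text \<open>
  The setting of the argument: \<open>T\<close> is the unconditional sum of finite rank operators
  \<open>C k\<close> with uniformly bounded finite partial sums. For a space with an unconditional
  finite-dimensional decomposition \<open>Q\<close> one takes \<open>C k = Q k \<circ> T\<close>. Finite rank enters only
  through the estimate in \<open>C_finite_rank\<close>.
\<close>

locale unconditional_embedding =
  fixes T :: "'a::banach \<Rightarrow>\<^sub>L 'b::banach" and C :: "nat \<Rightarrow> 'a \<Rightarrow>\<^sub>L 'b" and K :: real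
  assumes C_has_sum: "((\<lambda>k. C k x) has_sum T x) UNIV"
    and K_pos: "0 < K"
    and C_bound: "finite F \<Longrightarrow> norm (\<Sum>k\<in>F. C k) \<le> K"
    and C_finite_rank: "\<exists>D E. 0 \<le> D \<and> finite E \<and>
      (\<forall>v. norm (v o\<^sub>L C k) \<le> D * (\<Sum>e\<in>E. \<bar>blinfun_apply v e\<bar>))"
    and Schur: "very_strong_Schur TYPE('a \<Rightarrow>\<^sub>L real)"
begin

text \<open>
  The part of the restriction of \<open>v\<close> that lives on the blocks in \<open>F\<close>.
\<close>

definition piece :: "nat set \<Rightarrow> ('b \<Rightarrow>\<^sub>L real) \<Rightarrow> 'a \<Rightarrow>\<^sub>L real" where
  "piece F v = v o\<^sub>L (\<Sum>k\<in>F. C k)"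

lemma piece_apply: "piece F v x = (\<Sum>k\<in>F. v (C k x))"
  by (simp add: piece_def blinfun.sum_left blinfun.sum_right)

lemma piece_sum: "piece F v = (\<Sum>k\<in>F. v o\<^sub>L C k)"
  by (rule blinfun_eqI) (simp add: piece_apply blinfun.sum_left)

lemma piece_add: "piece F (v + w) = piece F v + piece F w"
  by (rule blinfun_eqI) (simp add: piece_apply blinfun.add_left sum.distrib)

lemma piece_Un:
  "finite F \<Longrightarrow> finite G \<Longrightarrow> F \<inter> G = {} \<Longrightarrow> piece (F \<union> G) v = piece F v + piece G v"
  by (rule blinfun_eqI) (simp add: piece_apply blinfun.add_left sum.union_disjoint)

lemma piece_empty: "piece {} v = 0" and piece_zero: "piece F 0 = 0"
  by (rule blinfun_eqI, simp add: piece_apply)+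

lemma norm_piece_le:
  assumes "finite F"
  shows "norm (piece F v) \<le> K * norm v"
proof -
  have "norm (piece F v) \<le> norm v * norm (\<Sum>k\<in>F. C k)"
    unfolding piece_def by (rule norm_blinfun_compose)
  also have "\<dots> \<le> norm v * K"
    by (rule mult_left_mono[OF C_bound[OF assms]]) simp
  finally show ?thesis by (simp add: mult.commute)
qed

text \<open>
  Weak* small functionals have small pieces on initial blocks.
\<close>

lemma piece_small_nbhd:
  assumes "0 < e"
  shows "\<exists>E. finite E \<and> (\<forall>v\<in>weak_star_nbhd E. \<forall>F\<subseteq>{..<N}. norm (piece F v) \<le> e)"
proof -
  obtain D E where DE: "\<And>k. 0 \<le> D k" "\<And>k. finite (E k)"
    "\<And>k v. norm (v o\<^sub>L C k) \<le> D k * (\<Sum>b\<in>E k. \<bar>blinfun_apply v b\<bar>)"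
  proof -
    let ?P = "\<lambda>k D E. 0 \<le> D \<and> finite E \<and>
      (\<forall>v. norm (v o\<^sub>L C k) \<le> D * (\<Sum>b\<in>E. \<bar>blinfun_apply v b\<bar>))"
    have "\<exists>D. \<forall>k. \<exists>E. ?P k (D k) E"
      by (intro choice allI C_finite_rank)
    then obtain D where "\<forall>k. \<exists>E. ?P k (D k) E" ..
    then have "\<exists>E. \<forall>k. ?P k (D k) (E k)"
      by (rule choice)
    then obtain E where "\<forall>k. ?P k (D k) (E k)" ..
    then show thesis
      by (intro that[of D E]) blast+
  qed
  define R where "R = (\<Sum>k<N. D k * card (E k))"
  have R: "0 \<le> R" unfolding R_def using DE(1) by (intro sum_nonneg) simp
  \<comment> \<open>The scaling factor makes \<open>\<bar>v b\<bar> < 1/s\<close> on all relevant \<open>b\<close>, so the sum of bounds is \<open>R/s \<le> e\<close>.\<close>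
  define s where "s = (R + 1) / e"
  have s: "0 < s" using R assms by (simp add: s_def)
  show ?thesis
  proof (intro exI[of _ "(\<lambda>b. s *\<^sub>R b) ` (\<Union>k<N. E k)"] conjI ballI allI impI)
    show "finite ((\<lambda>b. s *\<^sub>R b) ` (\<Union>k<N. E k))" using DE(2) by auto
    fix v :: "'b \<Rightarrow>\<^sub>L real" and F
    assume v: "v \<in> weak_star_nbhd ((\<lambda>b. s *\<^sub>R b) ` (\<Union>k<N. E k))" and F: "F \<subseteq> {..<N}"
    have small: "\<bar>v b\<bar> \<le> 1 / s" if "b \<in> E k" "k < N" for b k
      using v that unfolding weak_star_nbhd_scaled[OF s] by force
    have "norm (piece F v) \<le> (\<Sum>k\<in>F. norm (v o\<^sub>L C k))"
      unfolding piece_sum by (rule norm_sum)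
    also have "\<dots> \<le> (\<Sum>k<N. norm (v o\<^sub>L C k))"
      by (rule sum_mono2) (use F in auto)
    also have "\<dots> \<le> (\<Sum>k<N. D k * (\<Sum>b\<in>E k. 1 / s))"
      using DE(1) small by (intro sum_mono order_trans[OF DE(3)] mult_left_mono) auto
    also have "\<dots> = R * (1 / s)"
      by (simp add: R_def sum_divide_distrib)
    also have "\<dots> \<le> e"
      using R assms by (simp add: s_def field_simps)
    finally show "norm (piece F v) \<le> e" .
  qed
qed

lemma C_tail:
  assumes "0 < e"
  shows "\<exists>N. \<forall>F. finite F \<longrightarrow> F \<subseteq> {N..} \<longrightarrow> norm (\<Sum>k\<in>F. C k x) \<le> e"
proof -
  have "\<forall>\<^sub>F F in finite_subsets_at_top UNIV. dist (\<Sum>k\<in>F. C k x) (T x) < e / 2"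
    using C_has_sum[of x] assms unfolding has_sum_def tendsto_iff by (metis half_gt_zero)
  then obtain G where G: "finite G"
    "\<And>F. finite F \<Longrightarrow> G \<subseteq> F \<Longrightarrow> dist (\<Sum>k\<in>F. C k x) (T x) < e / 2"
    unfolding eventually_finite_subsets_at_top by auto
  obtain N where N: "G \<subseteq> {..<N}"
    using finite_nat_bounded[OF G(1)] by blast
  have "norm (\<Sum>k\<in>F. C k x) \<le> e" if F: "finite F" "F \<subseteq> {N..}" for F
  proof -
    have "F \<inter> G = {}" using N F by fastforce
    then have "(\<Sum>k\<in>F. C k x) = (\<Sum>k\<in>F \<union> G. C k x) - (\<Sum>k\<in>G. C k x)"
      using F G by (simp add: sum.union_disjoint)
    then have "norm (\<Sum>k\<in>F. C k x) = dist (\<Sum>k\<in>F \<union> G. C k x) (\<Sum>k\<in>G. C k x)"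
      by (simp add: dist_norm)
    also have "\<dots> \<le> dist (\<Sum>k\<in>F \<union> G. C k x) (T x) + dist (\<Sum>k\<in>G. C k x) (T x)"
      by (rule dist_triangle2)
    also have "\<dots> \<le> e"
      using G(2)[of "F \<union> G"] G(2)[of G] F G(1) by simp
    finally show ?thesis .
  qed
  then show ?thesis by blast
qed

text \<open>
  The series of pieces of \<open>v\<close> converges unconditionally in norm in the dual of \<open>X\<close>.
  Otherwise there are disjoint blocks \<open>F n\<close> whose pieces \<open>s n\<close> have norm above \<open>e\<close>. They can be
  chosen \<open>e/2\<close>-separated, and by uniform boundedness of partial sums every functional on that dual is
  absolutely summable along \<open>s\<close>. The tree \<open>l \<mapsto> s (last l)\<close> then violates the very strong Schur property.
\<close>

lemma piece_tail:
  assumes "0 < e"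
  shows "\<exists>N. \<forall>F. finite F \<longrightarrow> F \<subseteq> {N..} \<longrightarrow> norm (piece F v) \<le> e"
proof (rule ccontr)
  assume "\<not> ?thesis"
  then have big: "\<exists>F. finite F \<and> F \<subseteq> {N..} \<and> e < norm (piece F v)" for N
    by (metis not_le)
  define good where "good F N \<longleftrightarrow> finite F \<and> F \<subseteq> {..<N} \<and> e < norm (piece F v) \<and>
     (\<exists>x. norm x \<le> 1 \<and> e < piece F v x \<and>
       (\<forall>G. finite G \<longrightarrow> G \<subseteq> {N..} \<longrightarrow> \<bar>piece G v x\<bar> \<le> e / 2))" for F N
  have ex: "\<exists>F N. good F N \<and> F \<subseteq> {N0..} \<and> N0 \<le> N" for N0
  proof -
    obtain F where F: "finite F" "F \<subseteq> {N0..}" "e < norm (piece F v)"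
      using big by blast
    obtain x where x: "norm x \<le> 1" "e < piece F v x"
      using norm_blinfun_witness[OF F(3)] assms by auto
    define e' where "e' = e / (2 * (norm v + 1))"
    have e': "0 < e'" using assms by (simp add: e'_def add_nonneg_pos)
    obtain N1 where N1: "\<And>G. finite G \<Longrightarrow> G \<subseteq> {N1..} \<Longrightarrow> norm (\<Sum>k\<in>G. C k x) \<le> e'"
      using C_tail[OF e'] by blast
    obtain N2 where N2: "F \<subseteq> {..<N2}"
      using finite_nat_bounded[OF F(1)] by blast
    define N where "N = max N0 (max N1 N2)"
    have "\<bar>piece G v x\<bar> \<le> e / 2" if G: "finite G" "G \<subseteq> {N..}" for G
    proof -
      have "\<bar>piece G v x\<bar> \<le> norm v * norm (\<Sum>k\<in>G. C k x)"
        using norm_blinfun[of v "\<Sum>k\<in>G. C k x"] by (simp add: piece_apply blinfun.sum_right)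
      also have "\<dots> \<le> (norm v + 1) * e'"
        using G by (intro mult_mono N1) (auto simp: N_def)
      also have "\<dots> = e / 2"
        by (simp add: e'_def field_simps add_nonneg_eq_0_iff)
      finally show ?thesis .
    qed
    moreover have "F \<subseteq> {..<N}"
      using N2 by (auto simp: N_def)
    ultimately have "good F N"
      unfolding good_def using F(1,3) x by (intro conjI exI[of _ x]) auto
    then show ?thesis
      using F(2) by (intro exI[of _ F] exI[of _ N]) (simp add: N_def)
  qed
  have "\<exists>f. \<forall>n. good (fst (f n)) (snd (f n)) \<and>
      (fst (f (Suc n)) \<subseteq> {snd (f n)..} \<and> snd (f n) \<le> snd (f (Suc n)))"
  proof (rule dependent_nat_choice)
    show "\<exists>p. good (fst p) (snd p)"
      using ex[of 0] by (metis fst_conv snd_conv)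
    show "\<exists>q. good (fst q) (snd q) \<and> (fst q \<subseteq> {snd p..} \<and> snd p \<le> snd q)" for p :: "nat set \<times> nat"
      using ex[of "snd p"] by (metis fst_conv snd_conv)
  qed
  then obtain f where f: "\<And>n. good (fst (f n)) (snd (f n))"
    "\<And>n. fst (f (Suc n)) \<subseteq> {snd (f n)..}" "\<And>n. snd (f n) \<le> snd (f (Suc n))"
    by blast
  define F where "F n = fst (f n)" for n
  define N where "N n = snd (f n)" for n
  have fin: "finite (F n)" for n
    using f(1)[of n] unfolding good_def F_def by (elim conjE)
  have FN: "F n \<subseteq> {..<N n}" for n
    using f(1)[of n] unfolding good_def F_def N_def by (elim conjE)
  have "N n \<le> N (Suc n)" for n
    unfolding N_def by (rule f(3))
  then have Nmono: "N i \<le> N j" if "i \<le> j" for i j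
    using that by (rule lift_Suc_mono_le)
  have later: "F j \<subseteq> {N i..}" if ij: "i < j" for i j
  proof -
    obtain j' where "j = Suc j'" "i \<le> j'"
      using ij by (cases j) auto
    then show ?thesis
      using f(2)[of j'] Nmono[of i j'] unfolding F_def[symmetric] N_def[symmetric] by auto
  qed
  have disj: "F i \<inter> F j = {}" if "i \<noteq> j" for i j
    using that
  proof (induction i j rule: linorder_wlog)
    case (le i j)
    then show ?case using later[of i j] FN[of i] by fastforce
  qed (simp add: Int_commute)
  define s where "s n = piece (F n) v" for n
  have sep: "e / 2 \<le> norm (s i - s j)" if "i \<noteq> j" for i j
    using that
  proof (induction i j rule: linorder_wlog)
    case (le i j)
    then have "i < j" by simp
    obtain x where x: "norm x \<le> 1" "e < s i x"
      "\<And>G. finite G \<Longrightarrow> G \<subseteq> {N i..} \<Longrightarrow> \<bar>piece G v x\<bar> \<le> e / 2"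
      using f(1)[of i] unfolding good_def s_def F_def N_def by blast
    have "\<bar>s j x\<bar> \<le> e / 2"
      unfolding s_def using x(3) fin later[OF \<open>i < j\<close>] by blast
    then have "e / 2 \<le> \<bar>(s i - s j) x\<bar>"
      using x(2) by (simp add: blinfun.diff_left)
    also have "\<dots> \<le> norm (s i - s j) * norm x"
      using norm_blinfun[of "s i - s j" x] by simp
    also have "\<dots> \<le> norm (s i - s j)"
      using mult_left_mono[OF x(1), of "norm (s i - s j)"] by simp
    finally show ?case .
  qed (simp add: norm_minus_commute)
  have sum_s: "norm (\<Sum>n\<in>A. s n) \<le> K * norm v" if "finite A" for A
  proof -
    have "(\<Sum>n\<in>A. s n) = piece (\<Union>n\<in>A. F n) v"
      unfolding s_def piece_sum using that fin disj
      by (subst sum.UNION_disjoint) auto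
    then show ?thesis
      using norm_piece_le[of "\<Union>n\<in>A. F n" v] fin that by simp
  qed
  obtain c where c: "0 < c" and
    schur: "\<And>(x :: nat list \<Rightarrow> 'a \<Rightarrow>\<^sub>L real) M d. \<lbrakk>0 < d; \<And>l. norm (x l) \<le> M;
        \<And>l n m. n \<noteq> m \<Longrightarrow> d \<le> norm (x (l @ [n]) - x (l @ [m]))\<rbrakk> \<Longrightarrow>
      \<exists>s. strict_mono s \<and> (\<exists>\<phi> :: ('a \<Rightarrow>\<^sub>L real) \<Rightarrow>\<^sub>L real. norm \<phi> \<le> 1 \<and>
        (\<forall>n. c * d \<le> \<bar>blinfun_apply \<phi> (x (map s [0..<Suc n]))\<bar>))"
    using very_strong_Schur_lists[OF Schur] by metis
  have "\<exists>t. strict_mono t \<and> (\<exists>\<phi> :: ('a \<Rightarrow>\<^sub>L real) \<Rightarrow>\<^sub>L real. norm \<phi> \<le> 1 \<and>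
        (\<forall>n. c * (e / 2) \<le> \<bar>blinfun_apply \<phi> (s (last (map t [0..<Suc n])))\<bar>))"
    by (rule schur[of "e / 2" "\<lambda>l. s (last l)" "K * norm v"])
      (use assms sep fin in \<open>auto simp: s_def norm_piece_le\<close>)
  then obtain t :: "nat \<Rightarrow> nat" and \<phi> :: "('a \<Rightarrow>\<^sub>L real) \<Rightarrow>\<^sub>L real" where t: "strict_mono t" and \<phi>: "norm \<phi> \<le> 1"
    and low: "\<And>n. c * (e / 2) \<le> \<bar>blinfun_apply \<phi> (s (t n))\<bar>"
    by auto
  have up: "\<bar>\<Sum>n\<in>A. blinfun_apply \<phi> (s (t n))\<bar> \<le> K * norm v" if "finite A" for A
  proof -
    have "(\<Sum>n\<in>A. blinfun_apply \<phi> (s (t n))) = blinfun_apply \<phi> (\<Sum>n\<in>t ` A. s n)"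
      using strict_mono_imp_inj_on[OF t] by (simp add: blinfun.sum_right sum.reindex)
    also have "\<bar>\<dots>\<bar> \<le> norm \<phi> * norm (\<Sum>n\<in>t ` A. s n)"
      using norm_blinfun[of \<phi>] by simp
    also have "\<dots> \<le> 1 * (K * norm v)"
      using \<phi> sum_s[of "t ` A"] that by (intro mult_mono) auto
    finally show ?thesis by simp
  qed
  have "0 < c * (e / 2)" using c assms by simp
  then obtain n :: nat where n: "2 * (K * norm v) < n * (c * (e / 2))"
    using reals_Archimedean3 by blast
  have "real n * (c * (e / 2)) \<le> (\<Sum>i<n. \<bar>blinfun_apply \<phi> (s (t i))\<bar>)"
    using sum_mono[of "{..<n}" "\<lambda>_. c * (e / 2)" "\<lambda>i. \<bar>blinfun_apply \<phi> (s (t i))\<bar>"] low by simp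
  also have "\<dots> \<le> 2 * (K * norm v)"
    by (rule sum_abs_le_twice) (use up finite_subset in \<open>auto intro: up\<close>)
  finally show False using n by simp
qed

lemma norm_diff_piece_le:
  assumes "\<And>F. finite F \<Longrightarrow> F \<subseteq> {N..} \<Longrightarrow> norm (piece F v) \<le> e"
  shows "norm ((v o\<^sub>L T) - piece {..<N} v) \<le> e"
proof (rule norm_blinfun_bound)
  show "0 \<le> e" using assms[of "{}"] by (simp add: piece_empty)
  fix x
  have "((\<lambda>k. v (C k x)) has_sum v (T x)) UNIV"
    using has_sum_bounded_linear[OF blinfun.bounded_linear_right C_has_sum, of v x] by (simp add: o_def)
  then have "(\<lambda>k. v (C k x)) sums v (T x)"
    by (rule has_sum_imp_sums)
  then have "(\<lambda>m. \<Sum>k<m. v (C k x)) \<longlonglongrightarrow> v (T x)"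
    by (simp add: sums_def)
  then have "(\<lambda>m. \<bar>(\<Sum>k<m. v (C k x)) - piece {..<N} v x\<bar>) \<longlonglongrightarrow> \<bar>v (T x) - piece {..<N} v x\<bar>"
    by (intro tendsto_intros)
  moreover have "\<bar>(\<Sum>k<m. v (C k x)) - piece {..<N} v x\<bar> \<le> e * norm x" if "N \<le> m" for m
  proof -
    have "{..<m} = {..<N} \<union> {N..<m}" using that by auto
    then have "(\<Sum>k<m. v (C k x)) - piece {..<N} v x = piece {N..<m} v x"
      unfolding piece_apply by (simp only: sum.union_disjoint finite_lessThan finite_atLeastLessThan ivl_disj_int)
    also have "\<bar>\<dots>\<bar> \<le> norm (piece {N..<m} v) * norm x"
      using norm_blinfun[of "piece {N..<m} v" x] by simp
    also have "\<dots> \<le> e * norm x"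
      by (intro mult_right_mono assms) auto
    finally show ?thesis .
  qed
  ultimately have "\<bar>v (T x) - piece {..<N} v x\<bar> \<le> e * norm x"
    by (intro LIMSEQ_le_const2) auto
  then show "norm (((v o\<^sub>L T) - piece {..<N} v) x) \<le> e * norm x"
    by (simp add: blinfun.diff_left)
qed

text \<open>
  The restriction of a functional to the embedded space.
\<close>

definition restr :: "('b \<Rightarrow>\<^sub>L real) \<Rightarrow> 'a \<Rightarrow>\<^sub>L real" where
  "restr v = v o\<^sub>L T"

lemma restr_apply: "restr v x = v (T x)"
  by (simp add: restr_def)

section \<open>A game on the dual space\<close>

text \<open>
  The positions \<open>(y, r)\<close> from which the spoiler wins. A move by \<open>u\<close> (within the neighbourhood
  named by the opponent) leads to \<open>y + u\<close> and raises the threshold \<open>r\<close> by \<open>\<theta> \<parallel>R u\<parallel>\<close>; the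
  spoiler wins once the norm of the position is below the threshold. In a \<open>move\<close> he announces
  a lower bound \<open>d\<close> on the size before the opponent names the neighbourhood, because
  normalized answers are to be separated. In a \<open>silent\<close> move no bound is imposed and the
  threshold stays. Silent moves let every small step be accounted for; they cost nothing in the
  tree argument, since they do not contribute to the tree. Being inductive, the definition requires the
  spoiler to win in finite time.
\<close>

inductive spoilable :: "real \<Rightarrow> ('b \<Rightarrow>\<^sub>L real) \<Rightarrow> real \<Rightarrow> bool" for \<theta> where
  short: "norm y < r \<Longrightarrow> spoilable \<theta> y r"
| silent: "\<forall>E. finite E \<longrightarrow> (\<exists>u\<in>weak_star_nbhd E. spoilable \<theta> (y + u) r) \<Longrightarrow> spoilable \<theta> y r"
| move: "0 < d \<Longrightarrow> \<forall>E. finite E \<longrightarrow> (\<exists>u\<in>weak_star_nbhd E.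
      d \<le> norm (restr u) \<and> spoilable \<theta> (y + u) (r + \<theta> * norm (restr u))) \<Longrightarrow> spoilable \<theta> y r"

text \<open>
  If answers of size at least \<open>d\<close> exist in all weak* neighbourhoods, then a sequence of them
  can be chosen such that later ones nearly vanish at points where earlier ones are almost
  normed; so the normalized restrictions are separated.
\<close>

lemma separated_sequence:
  assumes d: "0 < d" and E0: "finite E0"
    and ex: "\<And>E. finite E \<Longrightarrow> \<exists>u\<in>weak_star_nbhd E. d \<le> norm (restr u) \<and> P u"
  obtains u :: "nat \<Rightarrow> 'b \<Rightarrow>\<^sub>L real" where
    "\<And>n. u n \<in> weak_star_nbhd E0" "\<And>n. d \<le> norm (restr (u n))" "\<And>n. P (u n)"
    "\<And>n m. n \<noteq> m \<Longrightarrow> 1 / 2 \<le> norm (sgn (restr (u n)) - sgn (restr (u m)))"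
proof -
  have "\<exists>x. norm x \<le> 1 \<and> 3 / 4 < sgn (restr u) x" if "d \<le> norm (restr u)" for u
  proof -
    have "norm (sgn (restr u)) = 1"
      using that d by (auto simp: norm_sgn)
    then have "3 / 4 < norm (sgn (restr u))" by simp
    from norm_blinfun_witness[OF this] show ?thesis by auto
  qed
  then obtain x where x: "\<And>u. d \<le> norm (restr u) \<Longrightarrow> norm (x u) \<le> 1"
    "\<And>u. d \<le> norm (restr u) \<Longrightarrow> 3 / 4 < sgn (restr u) (x u)"
    by metis
  \<comment> \<open>A later \<open>u\<close> with \<open>\<bar>u (z u')\<bar> < 1\<close> has normalized restriction below \<open>1/4\<close> at \<open>x u'\<close>, where \<open>u'\<close>
      itself exceeds \<open>3/4\<close>.\<close>
  define z where "z u = (4 / d) *\<^sub>R T (x u)" for u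
  let ?ok = "\<lambda>p. d \<le> norm (restr (fst p)) \<and> P (fst p) \<and> fst p \<in> weak_star_nbhd (snd p)
      \<and> finite (snd p) \<and> E0 \<subseteq> snd p"
  have extend: "\<exists>q. ?ok q \<and> E \<subseteq> snd q" if "finite E" for E
  proof -
    obtain u where "u \<in> weak_star_nbhd (E0 \<union> E)" "d \<le> norm (restr u)" "P u"
      using ex[of "E0 \<union> E"] E0 \<open>finite E\<close> by auto
    then show ?thesis
      using E0 \<open>finite E\<close> by (intro exI[of _ "(u, E0 \<union> E)"]) auto
  qed
  have "\<exists>f. \<forall>n. ?ok (f n) \<and> insert (z (fst (f n))) (snd (f n)) \<subseteq> snd (f (Suc n))"
  proof (rule dependent_nat_choice)
    show "\<exists>p. ?ok p" using extend[of "{}"] by blast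
    show "\<exists>q. ?ok q \<and> insert (z (fst p)) (snd p) \<subseteq> snd q" if "?ok p" for p
      using extend[of "insert (z (fst p)) (snd p)"] that by blast
  qed
  then obtain f where ok: "\<And>n. ?ok (f n)"
    and step: "\<And>n. insert (z (fst (f n))) (snd (f n)) \<subseteq> snd (f (Suc n))"
    by blast
  define u where "u n = fst (f n)" for n
  have "snd (f n) \<subseteq> snd (f (Suc n))" for n
    using step[of n] by (rule insert_subset[THEN iffD1, THEN conjunct2])
  then have mono: "snd (f i) \<subseteq> snd (f j)" if "i \<le> j" for i j
    using that by (rule lift_Suc_mono_le)
  have sep: "1 / 2 \<le> norm (sgn (restr (u i)) - sgn (restr (u j)))" if "i \<noteq> j" for i j
    using that
  proof (induction i j rule: linorder_wlog)
    case (le i j)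
    then have "Suc i \<le> j" by simp
    then have "z (u i) \<in> snd (f j)"
      using step[of i] mono[of "Suc i" j] by (auto simp: u_def)
    then have "\<bar>u j (z (u i))\<bar> < 1"
      using ok[of j] by (auto simp: weak_star_nbhd_def u_def)
    then have small: "\<bar>u j (T (x (u i)))\<bar> < d / 4"
      using d by (simp add: z_def blinfun.scaleR_right abs_mult field_simps)
    have di: "d \<le> norm (restr (u i))" and dj: "d \<le> norm (restr (u j))"
      using ok[of i] ok[of j] by (simp_all add: u_def)
    have "sgn (restr (u j)) (x (u i)) = u j (T (x (u i))) / norm (restr (u j))"
      by (simp add: sgn_div_norm blinfun.scaleR_left restr_apply divide_inverse)
    also have "\<dots> \<le> (d / 4) / d"
      using small d dj by (intro frac_le) auto
    finally have "1 / 2 \<le> (sgn (restr (u i)) - sgn (restr (u j))) (x (u i))"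
      using x(2)[OF di] d by (simp add: blinfun.diff_left)
    also have "\<dots> \<le> norm (sgn (restr (u i)) - sgn (restr (u j))) * norm (x (u i))"
      using norm_blinfun[of "sgn (restr (u i)) - sgn (restr (u j))" "x (u i)"] by simp
    also have "\<dots> \<le> norm (sgn (restr (u i)) - sgn (restr (u j)))"
      using mult_left_mono[OF x(1)[OF di], of "norm (sgn (restr (u i)) - sgn (restr (u j)))"] by simp
    finally show ?case .
  qed (simp add: norm_minus_commute)
  show thesis
  proof (rule that)
    fix n
    show "u n \<in> weak_star_nbhd E0" "d \<le> norm (restr (u n))" "P (u n)"
      using ok[of n] by (auto simp: u_def weak_star_nbhd_def)
  qed (rule sep)
qed

text \<open>
  What is known after a finite play from \<open>(y, r)\<close> won by the spoiler: \<open>w\<close> is the sum of all moves,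
  \<open>v 0, \<dots>, v (n - 1)\<close> are the non-silent ones. Every partial sum of the restrictions of the latter is,
  up to \<open>e\<close>, a piece of \<open>w\<close> on blocks beyond \<open>N\<close>, and \<open>w\<close> itself is negligible before \<open>N\<close>.
  The last two properties express that the moves are essentially disjoint blocks.
\<close>

definition outcome ::
  "real \<Rightarrow> ('b \<Rightarrow>\<^sub>L real) \<Rightarrow> real \<Rightarrow> nat \<Rightarrow> real \<Rightarrow> nat \<Rightarrow> (nat \<Rightarrow> 'b \<Rightarrow>\<^sub>L real) \<Rightarrow> ('b \<Rightarrow>\<^sub>L real) \<Rightarrow> bool" where
  "outcome \<theta> y r N e n v w \<longleftrightarrow>
    norm (y + w) < r + \<theta> * (\<Sum>i<n. norm (restr (v i))) \<and>
    (\<forall>J\<subseteq>{..<n}. \<exists>F. finite F \<and> F \<subseteq> {N..} \<and> norm ((\<Sum>i\<in>J. restr (v i)) - piece F w) \<le> e) \<and>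
    (\<forall>F\<subseteq>{..<N}. norm (piece F w) \<le> e)"

lemma outcome_silent:
  assumes o: "outcome \<theta> (y + u) r N' (e / 2) n v w" and N: "N \<le> N'"
    and low: "\<And>F. F \<subseteq> {..<N} \<Longrightarrow> norm (piece F u) \<le> e / 2"
    and high: "\<And>F. finite F \<Longrightarrow> F \<subseteq> {N'..} \<Longrightarrow> norm (piece F u) \<le> e / 2"
  shows "outcome \<theta> y r N e n v (u + w)"
  unfolding outcome_def
proof (intro conjI allI impI)
  show "norm (y + (u + w)) < r + \<theta> * (\<Sum>i<n. norm (restr (v i)))"
    using o by (simp add: outcome_def add.assoc)
  fix J assume "J \<subseteq> {..<n}"
  then obtain F where F: "finite F" "F \<subseteq> {N'..}"
    "norm ((\<Sum>i\<in>J. restr (v i)) - piece F w) \<le> e / 2"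
    using o unfolding outcome_def by blast
  have "norm ((\<Sum>i\<in>J. restr (v i)) - piece F (u + w)) \<le>
      norm ((\<Sum>i\<in>J. restr (v i)) - piece F w) + norm (piece F u)"
    using norm_triangle_ineq4[of "(\<Sum>i\<in>J. restr (v i)) - piece F w" "piece F u"]
    by (simp add: piece_add algebra_simps)
  also have "\<dots> \<le> e"
    using F(3) high[OF F(1,2)] by simp
  finally show "\<exists>F. finite F \<and> F \<subseteq> {N..} \<and> norm ((\<Sum>i\<in>J. restr (v i)) - piece F (u + w)) \<le> e"
    using F N by (intro exI[of _ F]) auto
next
  fix F assume F: "F \<subseteq> {..<N}"
  then have "norm (piece F w) \<le> e / 2"
    using o N unfolding outcome_def by (meson lessThan_subset_iff order_trans)
  then show "norm (piece F (u + w)) \<le> e"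
    using norm_triangle_ineq[of "piece F u" "piece F w"] low[OF F] by (simp add: piece_add)
qed

text \<open>
  Prepending a move \<open>u\<close> that essentially lives on the blocks from \<open>N\<close> to \<open>N'\<close>: if \<open>u\<close> belongs
  to the partial sum, then these blocks are added to the ones used for the rest of the play.
\<close>

lemma outcome_move:
  assumes o: "outcome \<theta> (y + u) (r + \<theta> * norm (restr u)) N' (e / 5) n v w" and N: "N \<le> N'"
    and low: "\<And>F. F \<subseteq> {..<N} \<Longrightarrow> norm (piece F u) \<le> e / 5"
    and high: "\<And>F. finite F \<Longrightarrow> F \<subseteq> {N'..} \<Longrightarrow> norm (piece F u) \<le> e / 5"
  shows "outcome \<theta> y r N e (Suc n) (case_nat u v) (u + w)"
  unfolding outcome_def
proof (intro conjI allI impI)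
  have e: "0 \<le> e" using low[of "{}"] by (simp add: piece_empty)
  show "norm (y + (u + w)) < r + \<theta> * (\<Sum>i<Suc n. norm (restr (case_nat u v i)))"
    using o by (simp add: outcome_def add.assoc sum.lessThan_Suc_shift algebra_simps del: sum.lessThan_Suc)
  have loww: "norm (piece F w) \<le> e / 5" if "F \<subseteq> {..<N'}" for F
    using o that unfolding outcome_def by blast
  fix J assume J: "J \<subseteq> {..<Suc n}"
  define J' where "J' = {i. Suc i \<in> J}"
  have J': "J' \<subseteq> {..<n}" using J by (auto simp: J'_def)
  then obtain F' where F': "finite F'" "F' \<subseteq> {N'..}"
    "norm ((\<Sum>i\<in>J'. restr (v i)) - piece F' w) \<le> e / 5"
    using o unfolding outcome_def by blast
  let ?S = "\<Sum>i\<in>J'. restr (v i)"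
  let ?I = "{N..<N'}"
  have "finite J" using J finite_subset by blast
  have JS: "J - {0} = Suc ` J'"
    by (auto simp: J'_def image_iff) (metis not0_implies_Suc)
  have S: "(\<Sum>i\<in>J - {0}. restr (case_nat u v i)) = ?S"
    unfolding JS by (simp add: sum.reindex)
  show "\<exists>F. finite F \<and> F \<subseteq> {N..} \<and>
      norm ((\<Sum>i\<in>J. restr (case_nat u v i)) - piece F (u + w)) \<le> e"
  proof (cases "0 \<in> J")
    case True
    have sumJ: "(\<Sum>i\<in>J. restr (case_nat u v i)) = restr u + ?S"
      using S sum.remove[OF \<open>finite J\<close> True, of "\<lambda>i. restr (case_nat u v i)"] by simp
    have "F' \<inter> ?I = {}" using F'(2) by auto
    then have pF: "piece (F' \<union> ?I) (u + w) = piece F' u + piece F' w + (piece ?I u + piece ?I w)"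
      using F'(1) by (simp add: piece_Un piece_add)
    have "{..<N'} = {..<N} \<union> ?I" using N by auto
    then have pI: "piece {..<N'} u = piece {..<N} u + piece ?I u"
      by (simp only: piece_Un finite_lessThan finite_atLeastLessThan ivl_disj_int)
    have I: "?I \<subseteq> {..<N'}" by auto
    have 1: "norm (restr u - piece {..<N'} u) \<le> e / 5"
      unfolding restr_def by (rule norm_diff_piece_le[OF high])
    have "(restr u + ?S) - piece (F' \<union> ?I) (u + w) =
      (restr u - piece {..<N'} u) + (piece {..<N} u + ((?S - piece F' w) + (- piece F' u + - piece ?I w)))"
      unfolding pF pI by (simp add: algebra_simps)
    also have "norm \<dots> \<le> norm (restr u - piece {..<N'} u) + (norm (piece {..<N} u) +
        (norm (?S - piece F' w) + (norm (- piece F' u) + norm (- piece ?I w))))"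
      by (intro order_trans[OF norm_triangle_ineq] add_left_mono order_refl)
    also have "\<dots> \<le> e / 5 + (e / 5 + (e / 5 + (e / 5 + e / 5)))"
      using 1 low[of "{..<N}"] F'(3) high[OF F'(1,2)] loww[OF I]
      by (intro add_mono) auto
    finally show ?thesis
      using F' N unfolding sumJ by (intro exI[of _ "F' \<union> ?I"]) auto
  next
    case False
    then have sumJ: "(\<Sum>i\<in>J. restr (case_nat u v i)) = ?S" using S by simp
    have "norm (?S - piece F' (u + w)) \<le> norm (?S - piece F' w) + norm (piece F' u)"
      using norm_triangle_ineq4[of "?S - piece F' w" "piece F' u"]
      by (simp add: piece_add algebra_simps)
    also have "\<dots> \<le> e"
      using F'(3) high[OF F'(1,2)] e by simp
    finally show ?thesis
      using F' N unfolding sumJ by (intro exI[of _ F']) auto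
  qed
next
  fix F assume F: "F \<subseteq> {..<N}"
  have e: "0 \<le> e" using low[of "{}"] by (simp add: piece_empty)
  have "norm (piece F w) \<le> e / 5"
    using o N F unfolding outcome_def by (meson lessThan_subset_iff order_trans)
  then show "norm (piece F (u + w)) \<le> e"
    using norm_triangle_ineq[of "piece F u" "piece F w"] low[OF F] e by (simp add: piece_add)
qed

text \<open>
  A tree of functionals whose normalized restrictions satisfy the separation
  hypothesis of the very strong Schur property. The root is disregarded.
\<close>

definition separated_tree :: "(nat list \<Rightarrow> 'b \<Rightarrow>\<^sub>L real) \<Rightarrow> bool" where
  "separated_tree V \<longleftrightarrow> (\<forall>l. l \<noteq> [] \<longrightarrow> restr (V l) \<noteq> 0) \<and>
    (\<forall>l n m. n \<noteq> m \<longrightarrow> 1 / 2 \<le> norm (sgn (restr (V (l @ [n]))) - sgn (restr (V (l @ [m])))))"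

lemma separated_tree_graft:
  assumes "\<And>k. restr (u k) \<noteq> 0" "\<And>k. separated_tree (W k)"
    and "\<And>n m. n \<noteq> m \<Longrightarrow> 1 / 2 \<le> norm (sgn (restr (u n)) - sgn (restr (u m)))"
  shows "separated_tree (graft u W)"
  unfolding separated_tree_def
proof (intro conjI allI impI)
  fix l :: "nat list" assume "l \<noteq> []"
  then show "restr (graft u W l) \<noteq> 0"
    using assms(1,2) by (cases l) (auto simp: graft_def separated_tree_def)
next
  fix l and n m :: nat assume "n \<noteq> m"
  then show "1 / 2 \<le> norm (sgn (restr (graft u W (l @ [n]))) - sgn (restr (graft u W (l @ [m]))))"
    using assms(2,3) by (cases l) (simp_all add: graft_def separated_tree_def)
qed

text \<open>
  The answers of a winning spoiler, organized as a tree along all of whose branches he wins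
  in finite time. The induction follows the derivation of \<open>spoilable\<close> and strengthens \<open>N\<close>
  and \<open>e\<close> along the way. After the win the tree must still continue; \<open>d0\<close> provides
  separated vectors for this purpose.
\<close>

lemma spoilable_imp_tree:
  assumes "spoilable \<theta> y r"
    and d0: "0 < d0" and root: "\<And>E. finite E \<Longrightarrow> \<exists>u\<in>weak_star_nbhd E. d0 \<le> norm (restr u)"
    and "0 < e"
  shows "\<exists>V. separated_tree V \<and> (\<forall>s. \<exists>n w. outcome \<theta> y r N e n (\<lambda>i. V (map s [0..<Suc i])) w)"
  using assms(1) \<open>0 < e\<close>
proof (induction arbitrary: N e rule: spoilable.induct)
  case (short y r)
  have ex: "\<exists>u\<in>weak_star_nbhd E. d0 \<le> norm (restr u) \<and> True" if "finite E" for E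
    using root that by simp
  obtain u :: "nat \<Rightarrow> 'b \<Rightarrow>\<^sub>L real" where d: "\<And>n. d0 \<le> norm (restr (u n))"
    and sep: "\<And>n m. n \<noteq> m \<Longrightarrow> 1 / 2 \<le> norm (sgn (restr (u n)) - sgn (restr (u m)))"
    by (rule separated_sequence[of d0 "{}" "\<lambda>_. True", OF d0 finite.emptyI ex]) (assumption, rule that)
  have "separated_tree (\<lambda>l. u (last l))"
    using d sep d0 by (auto simp: separated_tree_def) (metis norm_zero not_le)
  moreover have "outcome \<theta> y r N e 0 v 0" for v
    using short by (auto simp: outcome_def piece_zero intro!: exI[of _ "{}"])
  ultimately show ?case by blast
next
  case (silent y r)
  obtain E where E: "finite E" "\<forall>v\<in>weak_star_nbhd E. \<forall>F\<subseteq>{..<N}. norm (piece F v) \<le> e / 2"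
    using piece_small_nbhd[of "e / 2" N] silent.prems by auto
  then obtain u where u: "u \<in> weak_star_nbhd E"
    and IH: "\<And>N e. 0 < e \<Longrightarrow> \<exists>V. separated_tree V \<and>
      (\<forall>s. \<exists>n w. outcome \<theta> (y + u) r N e n (\<lambda>i. V (map s [0..<Suc i])) w)"
    using silent.IH by blast
  obtain N0 where N0: "\<And>F. finite F \<Longrightarrow> F \<subseteq> {N0..} \<Longrightarrow> norm (piece F u) \<le> e / 2"
    using piece_tail[of "e / 2" u] silent.prems by auto
  obtain V where V: "separated_tree V"
    "\<And>s. \<exists>n w. outcome \<theta> (y + u) r (max N N0) (e / 2) n (\<lambda>i. V (map s [0..<Suc i])) w"
    using IH[of "e / 2" "max N N0"] silent.prems by auto
  have "outcome \<theta> y r N e n v (u + w)" if "outcome \<theta> (y + u) r (max N N0) (e / 2) n v w" for n v w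
    using that
  proof (rule outcome_silent)
    show "norm (piece F u) \<le> e / 2" if "finite F" "F \<subseteq> {max N N0..}" for F
      using that by (intro N0) auto
  qed (use E u in auto)
  with V show ?case by blast
next
  case (move d y r)
  let ?Q = "\<lambda>u. \<forall>N e. 0 < e \<longrightarrow> (\<exists>V. separated_tree V \<and>
      (\<forall>s. \<exists>n w. outcome \<theta> (y + u) (r + \<theta> * norm (restr u)) N e n (\<lambda>i. V (map s [0..<Suc i])) w))"
  obtain E where E: "finite E" "\<forall>v\<in>weak_star_nbhd E. \<forall>F\<subseteq>{..<N}. norm (piece F v) \<le> e / 5"
    using piece_small_nbhd[of "e / 5" N] move.prems by auto
  have ex: "\<exists>u\<in>weak_star_nbhd E'. d \<le> norm (restr u) \<and> ?Q u" if "finite E'" for E'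
    using move.IH that by blast
  obtain u :: "nat \<Rightarrow> 'b \<Rightarrow>\<^sub>L real" where uE: "\<And>k. u k \<in> weak_star_nbhd E" and ud: "\<And>k. d \<le> norm (restr (u k))"
    and Q: "\<And>k. ?Q (u k)"
    and sep: "\<And>n m. n \<noteq> m \<Longrightarrow> 1 / 2 \<le> norm (sgn (restr (u n)) - sgn (restr (u m)))"
    by (rule separated_sequence[of d E ?Q, OF move.hyps(1) E(1) ex]) (assumption, rule that)
  have "\<exists>N0. \<forall>F. finite F \<longrightarrow> F \<subseteq> {N0..} \<longrightarrow> norm (piece F (u k)) \<le> e / 5" for k
    using piece_tail[of "e / 5" "u k"] move.prems by auto
  then obtain M where M: "\<And>k F. finite F \<Longrightarrow> F \<subseteq> {M k..} \<Longrightarrow> norm (piece F (u k)) \<le> e / 5"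
    by metis
  have "\<forall>k. \<exists>V. separated_tree V \<and> (\<forall>s. \<exists>n w. outcome \<theta> (y + u k) (r + \<theta> * norm (restr (u k)))
      (max N (M k)) (e / 5) n (\<lambda>i. V (map s [0..<Suc i])) w)"
    using Q move.prems by auto
  then obtain W where W: "\<And>k. separated_tree (W k)"
    and Wo: "\<And>k s. \<exists>n w. outcome \<theta> (y + u k) (r + \<theta> * norm (restr (u k)))
      (max N (M k)) (e / 5) n (\<lambda>i. W k (map s [0..<Suc i])) w"
    by metis
  have "separated_tree (graft u W)"
    using ud move.hyps(1) W sep by (intro separated_tree_graft) (metis norm_zero not_le)
  moreover have "\<exists>n w. outcome \<theta> y r N e n (\<lambda>i. graft u W (map s [0..<Suc i])) w" for s
  proof -
    obtain n w where o: "outcome \<theta> (y + u (s 0)) (r + \<theta> * norm (restr (u (s 0))))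
      (max N (M (s 0))) (e / 5) n (\<lambda>i. W (s 0) (map (s \<circ> Suc) [0..<Suc i])) w"
      using Wo by blast
    have "outcome \<theta> y r N e (Suc n) (\<lambda>i. graft u W (map s [0..<Suc i])) (u (s 0) + w)"
      unfolding graft_branch using o
    proof (rule outcome_move)
      show "norm (piece F (u (s 0))) \<le> e / 5" if "finite F" "F \<subseteq> {max N (M (s 0))..}" for F
        using that by (intro M) auto
    qed (use E uE in auto)
    then show ?thesis by blast
  qed
  ultimately show ?case by blast
qed

text \<open>
  The central estimate. The choice of \<open>\<theta>\<close> depends only on \<open>K\<close> and on the constant
  in the very strong Schur property.
\<close>

lemma zero_not_spoilable:
  obtains \<theta> where "0 < \<theta>" "\<not> spoilable \<theta> 0 (- 1)"
proof -
  obtain c where c: "0 < c" and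
    schur: "\<And>(x :: nat list \<Rightarrow> 'a \<Rightarrow>\<^sub>L real) M d. \<lbrakk>0 < d; \<And>l. norm (x l) \<le> M;
        \<And>l n m. n \<noteq> m \<Longrightarrow> d \<le> norm (x (l @ [n]) - x (l @ [m]))\<rbrakk> \<Longrightarrow>
      \<exists>s. strict_mono s \<and> (\<exists>\<phi> :: ('a \<Rightarrow>\<^sub>L real) \<Rightarrow>\<^sub>L real. norm \<phi> \<le> 1 \<and>
        (\<forall>n. c * d \<le> \<bar>blinfun_apply \<phi> (x (map s [0..<Suc n]))\<bar>))"
    using very_strong_Schur_lists[OF Schur] by metis
  define \<theta> where "\<theta> = c / (4 * K)"
  have \<theta>: "0 < \<theta>" using c K_pos by (simp add: \<theta>_def)
  have "\<not> spoilable \<theta> 0 (- 1)"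
  proof
    assume spoil0: "spoilable \<theta> 0 (- 1)"
    show False
    proof (cases "\<exists>d0>0. \<forall>E. finite E \<longrightarrow> (\<exists>u\<in>weak_star_nbhd E. d0 \<le> norm (restr u))")
      case False
      \<comment> \<open>Without moves of positive size the threshold never changes, so it must have been positive.\<close>
      have "spoilable \<theta> y r \<Longrightarrow> 0 < r" for y r
      proof (induction rule: spoilable.induct)
        case (short y r)
        then show ?case using norm_ge_zero order_le_less_trans by blast
      next
        case (silent y r)
        then show ?case by blast
      next
        case (move d y r)
        then show ?case using False by meson
      qed
      with spoil0 show False by fastforce
    next
      case True
      then obtain d0 where d0: "0 < d0"
        "\<And>E. finite E \<Longrightarrow> \<exists>u\<in>weak_star_nbhd E. d0 \<le> norm (restr u)"
        by blast
      have "0 < K / 2" using K_pos by simp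
      from spoilable_imp_tree[OF spoil0 d0 this] obtain V where V: "separated_tree V"
        and out: "\<And>s. \<exists>n w. outcome \<theta> 0 (- 1) 0 (K / 2) n (\<lambda>i. V (map s [0..<Suc i])) w"
        by blast
      have "\<exists>s. strict_mono s \<and> (\<exists>\<phi> :: ('a \<Rightarrow>\<^sub>L real) \<Rightarrow>\<^sub>L real. norm \<phi> \<le> 1 \<and>
        (\<forall>n. c * (1 / 2) \<le> \<bar>blinfun_apply \<phi> (sgn (restr (V (map s [0..<Suc n]))))\<bar>))"
        using V unfolding separated_tree_def
        by (intro schur[of "1 / 2" _ 1]) (auto simp: norm_sgn)
      then obtain s :: "nat \<Rightarrow> nat" and \<phi> :: "('a \<Rightarrow>\<^sub>L real) \<Rightarrow>\<^sub>L real" where \<phi>: "norm \<phi> \<le> 1"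
        and low: "\<And>n. c * (1 / 2) \<le> \<bar>blinfun_apply \<phi> (sgn (restr (V (map s [0..<Suc n]))))\<bar>"
        by blast
      obtain n w where o: "outcome \<theta> 0 (- 1) 0 (K / 2) n (\<lambda>i. V (map s [0..<Suc i])) w"
        using out by blast
      define v where "v i = V (map s [0..<Suc i])" for i
      define S where "S = (\<Sum>i<n. norm (restr (v i)))"
      define a where "a i = blinfun_apply \<phi> (restr (v i))" for i
      have w: "norm w < - 1 + \<theta> * S"
        using o by (simp add: outcome_def v_def[symmetric] S_def del: upt_Suc)
      \<comment> \<open>The initial threshold \<open>-1\<close> pays for the error \<open>K/2\<close> and leaves a strict gain.\<close>
      have up: "\<bar>\<Sum>i\<in>J. a i\<bar> \<le> c / 4 * S - K / 2" if "J \<subseteq> {..<n}" for J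
      proof -
        obtain F where F: "finite F" "norm ((\<Sum>i\<in>J. restr (v i)) - piece F w) \<le> K / 2"
          using o \<open>J \<subseteq> {..<n}\<close> unfolding outcome_def v_def[symmetric] by blast
        have "(\<Sum>i\<in>J. a i) = \<phi> (\<Sum>i\<in>J. restr (v i))"
          by (simp add: a_def blinfun.sum_right)
        also have "\<bar>\<dots>\<bar> \<le> norm \<phi> * norm (\<Sum>i\<in>J. restr (v i))"
          using norm_blinfun[of \<phi>] by simp
        also have "\<dots> \<le> norm (\<Sum>i\<in>J. restr (v i))"
          using \<phi> by (simp add: mult_left_le_one_le)
        also have "\<dots> \<le> K / 2 + norm (piece F w)"
          using F(2) norm_triangle_sub[of "\<Sum>i\<in>J. restr (v i)" "piece F w"] by simp
        also have "\<dots> \<le> K / 2 + K * norm w"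
          using norm_piece_le[OF F(1)] by simp
        also have "\<dots> \<le> K / 2 + K * (- 1 + \<theta> * S)"
          using w K_pos by simp
        also have "\<dots> = c / 4 * S - K / 2"
          using K_pos by (simp add: \<theta>_def field_simps)
        finally show ?thesis .
      qed
      have ge: "c / 2 * norm (restr (v i)) \<le> \<bar>a i\<bar>" for i
      proof -
        have "a i = norm (restr (v i)) * \<phi> (sgn (restr (v i)))"
          by (cases "restr (v i) = 0") (simp_all add: a_def sgn_div_norm blinfun.scaleR_right)
        then show ?thesis
          using mult_left_mono[OF low[of i], of "norm (restr (v i))"]
          by (simp add: v_def[symmetric] abs_mult mult.commute del: upt_Suc)
      qed
      have "c / 2 * S \<le> (\<Sum>i<n. \<bar>a i\<bar>)"
        unfolding S_def sum_distrib_left by (intro sum_mono ge)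
      also have "\<dots> \<le> 2 * (c / 4 * S - K / 2)"
        by (rule sum_abs_le_twice) (use up in \<open>auto intro: less_imp_le\<close>)
      finally show False using K_pos by simp
    qed
  qed
  with \<theta> show thesis by (rule that)
qed

text \<open>
  In other words, the value of the game is a 1-Lipschitz function of \<open>y\<close>.
\<close>

lemma spoilable_mono:
  assumes "spoilable \<theta> y' r'" and "r' + norm (y - y') \<le> r"
  shows "spoilable \<theta> y r"
  using assms
proof (induction arbitrary: y r rule: spoilable.induct)
  case (short y' r')
  then have "norm y < r"
    using norm_triangle_sub[of y y'] by linarith
  then show ?case by (rule spoilable.short)
next
  case (silent y' r')
  have "spoilable \<theta> (y + u) r" if "\<And>y r. r' + norm (y - (y' + u)) \<le> r \<Longrightarrow> spoilable \<theta> y r" for u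
    using silent.prems by (intro that) simp
  then show ?case
    using silent.IH by (intro spoilable.silent) blast
next
  case (move d y' r')
  have "spoilable \<theta> (y + u) (r + \<theta> * norm (restr u))"
    if "\<And>y r. (r' + \<theta> * norm (restr u)) + norm (y - (y' + u)) \<le> r \<Longrightarrow> spoilable \<theta> y r" for u
    using move.prems by (intro that) simp
  then show ?case
    using move.IH by (intro spoilable.move[OF move.hyps(1)]) blast
qed

text \<open>
  The opponent can keep a position safe under every small step, including those of
  size below \<open>d\<close>, at the price of an additional \<open>\<theta> d\<close> in the threshold.
\<close>

lemma not_spoilable_nbhd:
  assumes nb: "\<not> spoilable \<theta> y r" and d: "0 < d" and \<theta>: "0 \<le> \<theta>"
  obtains E where "finite E"
    "\<And>u. u \<in> weak_star_nbhd E \<Longrightarrow> \<not> spoilable \<theta> (y + u) (r + \<theta> * norm (restr u) - \<theta> * d)"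
proof -
  have "\<not> (\<forall>E. finite E \<longrightarrow> (\<exists>u\<in>weak_star_nbhd E. spoilable \<theta> (y + u) r))"
    using nb by (rule contrapos_nn) (rule spoilable.silent)
  then obtain E1 where E1: "finite E1" "\<And>u. u \<in> weak_star_nbhd E1 \<Longrightarrow> \<not> spoilable \<theta> (y + u) r"
    by blast
  have "\<not> (\<forall>E. finite E \<longrightarrow> (\<exists>u\<in>weak_star_nbhd E.
      d \<le> norm (restr u) \<and> spoilable \<theta> (y + u) (r + \<theta> * norm (restr u))))"
    using nb by (rule contrapos_nn) (rule spoilable.move[OF d])
  then obtain E2 where E2: "finite E2" "\<And>u. u \<in> weak_star_nbhd E2 \<Longrightarrow> d \<le> norm (restr u) \<Longrightarrow>
      \<not> spoilable \<theta> (y + u) (r + \<theta> * norm (restr u))"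
    by blast
  show thesis
  proof
    show "finite (E1 \<union> E2)" using E1 E2 by simp
    fix u assume u: "u \<in> weak_star_nbhd (E1 \<union> E2)"
    show "\<not> spoilable \<theta> (y + u) (r + \<theta> * norm (restr u) - \<theta> * d)"
    proof (cases "d \<le> norm (restr u)")
      case True
      then have "\<not> spoilable \<theta> (y + u) (r + \<theta> * norm (restr u))"
        using E2(2) u by (simp add: weak_star_nbhd_Un)
      then show ?thesis
        using spoilable_mono[of \<theta> "y + u" "r + \<theta> * norm (restr u) - \<theta> * d" "y + u"
            "r + \<theta> * norm (restr u)"] \<theta> d by auto
    next
      case False
      then have "\<theta> * norm (restr u) - \<theta> * d \<le> 0"
        using \<theta> by (simp add: mult_left_mono)
      moreover have "\<not> spoilable \<theta> (y + u) r"
        using E1(2) u by (simp add: weak_star_nbhd_Un)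
      ultimately show ?thesis
        using spoilable_mono[of \<theta> "y + u" "r + \<theta> * norm (restr u) - \<theta> * d" "y + u" r] by auto
    qed
  qed
qed

section \<open>A weak*-null norming sequence\<close>

lemma (in -) open_eval_nbhd:
  fixes x :: "'c \<Rightarrow> real"
  assumes "finite E"
  shows "open {g. \<forall>e\<in>E. \<bar>g e - x e\<bar> < c e}"
proof -
  have "open {g. \<bar>g e - x e\<bar> < c e}" for e
    by (intro open_Collect_less continuous_intros) simp_all
  then have "open (\<Inter>e\<in>E. {g. \<bar>g e - x e\<bar> < c e})"
    using assms by (intro open_INT) auto
  moreover have "(\<Inter>e\<in>E. {g. \<bar>g e - x e\<bar> < c e}) = {g. \<forall>e\<in>E. \<bar>g e - x e\<bar> < c e}"
    by blast
  ultimately show ?thesis by simp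
qed

text \<open>
  A state at level \<open>i\<close> consists of a functional \<open>z\<close> in the dual ball, a threshold \<open>r\<close> at which
  \<open>z\<close> is safe, and a weak* open set \<open>G\<close> of functionals (as plain functions). For all members of \<open>G\<close> in the ball
  the step from \<open>z\<close> is safe up to a loss of \<open>\<theta> 2\<^sup>-\<^sup>i\<close> and close to \<open>0\<close> at the first \<open>i\<close> members of the
  dense sequence \<open>dn\<close>. The square in the last condition leaves \<open>2\<^sup>-\<^sup>i\<close> after the increment has
  been divided by a number not below \<open>2\<^sup>-\<^sup>i\<close>.
\<close>

definition good_state ::
  "real \<Rightarrow> (nat \<Rightarrow> 'a) \<Rightarrow> nat \<Rightarrow> ('b \<Rightarrow>\<^sub>L real) \<times> real \<times> ('b \<Rightarrow> real) set \<Rightarrow> bool" where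
  "good_state \<theta> dn i s \<longleftrightarrow> (case s of (z, r, G) \<Rightarrow>
    norm z \<le> 1 \<and> \<not> spoilable \<theta> z r \<and> open G \<and>
    (\<forall>x. norm x \<le> 1 \<longrightarrow> blinfun_apply x \<in> G \<longrightarrow>
      \<not> spoilable \<theta> x (r + \<theta> * norm (restr (x - z)) - \<theta> * (1 / 2) ^ i) \<and>
      (\<forall>j<i. \<bar>restr (x - z) (dn j)\<bar> \<le> (1 / 2) ^ i * (1 / 2) ^ i)))"

text \<open>
  The open sets of the states in \<open>S\<close> cover the dual ball.
\<close>

definition covers :: "(('b \<Rightarrow>\<^sub>L real) \<times> real \<times> ('b \<Rightarrow> real) set) set \<Rightarrow> bool" where
  "covers S \<longleftrightarrow> (\<forall>x. norm x \<le> 1 \<longrightarrow> (\<exists>s\<in>S. blinfun_apply x \<in> snd (snd s)))"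

text \<open>
  The functional of \<open>s'\<close> is a point of the open set of \<open>s\<close>, and its threshold is the
  one at which this point is safe according to \<open>s\<close>.
\<close>

definition child :: "real \<Rightarrow> nat \<Rightarrow> ('b \<Rightarrow>\<^sub>L real) \<times> real \<times> ('b \<Rightarrow> real) set \<Rightarrow>
    ('b \<Rightarrow>\<^sub>L real) \<times> real \<times> ('b \<Rightarrow> real) set \<Rightarrow> bool" where
  "child \<theta> i s s' \<longleftrightarrow> norm (fst s') \<le> 1 \<and> blinfun_apply (fst s') \<in> snd (snd s) \<and>
    fst (snd s') = fst (snd s) + \<theta> * norm (restr (fst s' - fst s)) - \<theta> * (1 / 2) ^ i"

text \<open>
  Each point of the ball is the functional of a state whose parent lies in \<open>S\<close>; compactness
  leaves finitely many such states.
\<close>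

lemma next_level:
  assumes \<theta>: "0 \<le> \<theta>" and S: "\<And>s. s \<in> S \<Longrightarrow> good_state \<theta> dn i s" and cov: "covers S"
  shows "\<exists>S'. finite S' \<and> (\<forall>s'\<in>S'. good_state \<theta> dn (Suc i) s') \<and> covers S' \<and>
    (\<forall>s'\<in>S'. \<exists>s\<in>S. child \<theta> i s s')"
proof -
  let ?e = "(1 / 2 :: real) ^ Suc i"
  have "\<exists>s'. fst s' = x \<and> good_state \<theta> dn (Suc i) s' \<and> blinfun_apply x \<in> snd (snd s') \<and>
    (\<exists>s\<in>S. child \<theta> i s s')" if x: "norm x \<le> 1" for x
  proof -
    obtain s where s: "s \<in> S" "blinfun_apply x \<in> snd (snd s)"
      using cov x by (auto simp: covers_def)
    obtain z r G where zrG: "s = (z, r, G)" by (cases s)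
    define r' where "r' = r + \<theta> * norm (restr (x - z)) - \<theta> * (1 / 2) ^ i"
    have nb: "\<not> spoilable \<theta> x r'"
      using S[OF s(1)] x s(2) by (simp add: good_state_def zrG r'_def)
    obtain E where E: "finite E"
      "\<And>u. u \<in> weak_star_nbhd E \<Longrightarrow> \<not> spoilable \<theta> (x + u) (r' + \<theta> * norm (restr u) - \<theta> * ?e)"
      using not_spoilable_nbhd[OF nb, of ?e] \<theta> by auto
    define G' where "G' = {g. \<forall>e\<in>E. \<bar>g e - x e\<bar> < 1} \<inter>
      {g. \<forall>e\<in>(\<lambda>j. T (dn j)) ` {..<Suc i}. \<bar>g e - x e\<bar> < ?e * ?e}"
    have "open G'"
      unfolding G'_def by (intro open_Int open_eval_nbhd E(1)) auto
    have "\<not> spoilable \<theta> y (r' + \<theta> * norm (restr (y - x)) - \<theta> * ?e)" if "blinfun_apply y \<in> G'" for y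
      using E(2)[of "y - x"] that by (auto simp: G'_def weak_star_nbhd_def blinfun.diff_left)
    moreover have "\<bar>restr (y - x) (dn j)\<bar> \<le> ?e * ?e" if "blinfun_apply y \<in> G'" "j < Suc i" for y j
      using that by (auto simp: G'_def restr_apply blinfun.diff_left intro!: less_imp_le)
    ultimately have "good_state \<theta> dn (Suc i) (x, r', G')"
      using x nb \<open>open G'\<close> unfolding good_state_def by blast
    moreover have "blinfun_apply x \<in> G'"
      by (simp add: G'_def)
    moreover have "child \<theta> i s (x, r', G')"
      using x s(2) by (simp add: child_def zrG r'_def)
    ultimately show ?thesis
      using s(1) by (intro exI[of _ "(x, r', G')"]) auto
  qed
  then obtain st where st: "\<And>x. norm x \<le> 1 \<Longrightarrow> good_state \<theta> dn (Suc i) (st x)"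
    "\<And>x. norm x \<le> 1 \<Longrightarrow> blinfun_apply x \<in> snd (snd (st x))"
    "\<And>x. norm x \<le> 1 \<Longrightarrow> \<exists>s\<in>S. child \<theta> i s (st x)"
    by metis
  let ?B = "{x :: 'b \<Rightarrow>\<^sub>L real. norm x \<le> 1}"
  have op: "\<And>x. x \<in> ?B \<Longrightarrow> open (snd (snd (st x)))"
    using st(1) by (auto simp: good_state_def split_beta)
  have cv: "{blinfun_apply y |y :: 'b \<Rightarrow>\<^sub>L real. norm y \<le> 1} \<subseteq> (\<Union>x\<in>?B. snd (snd (st x)))"
    using st(2) by auto
  obtain D where D: "D \<subseteq> ?B" "finite D"
    "{blinfun_apply y |y :: 'b \<Rightarrow>\<^sub>L real. norm y \<le> 1} \<subseteq> (\<Union>x\<in>D. snd (snd (st x)))"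
    by (rule compactE_image[OF compact_dual_ball op cv])
  have "covers (st ` D)"
    using D(3) unfolding covers_def by blast
  then show ?thesis
    using D(1,2) st(1,3) by (intro exI[of _ "st ` D"] conjI ballI) blast+
qed

text \<open>
  The members of \<open>f\<close> are the restricted increments between parents and children at
  successive levels, each divided by the larger of its norm and \<open>2\<^sup>-\<^sup>i\<close>. Along a chain of states the
  thresholds rise by \<open>\<theta>\<close> times the norms of the increments, up to a summable loss, and never exceed \<open>1\<close>;
  this bounds the total variation and hence the constant \<open>M\<close>.
\<close>

lemma weak_star_null_norming_sequence:
  fixes dn :: "nat \<Rightarrow> 'a"
  assumes dense: "\<And>x e. 0 < e \<Longrightarrow> \<exists>j. norm (x - dn j) < e"
  obtains f :: "nat \<Rightarrow> 'a \<Rightarrow>\<^sub>L real" and M where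
    "\<And>n. norm (f n) \<le> 1" "\<And>x. (\<lambda>n. f n x) \<longlonglongrightarrow> 0"
    "\<And>x m. (\<And>n. \<bar>f n x\<bar> \<le> m) \<Longrightarrow> norm (T x) \<le> M * m"
proof -
  obtain \<theta> where \<theta>: "0 < \<theta>" and nb0: "\<not> spoilable \<theta> 0 (- 1)"
    by (rule zero_not_spoilable)
  \<comment> \<open>Low enough for every point of the ball to be safe after the first step, which starts at \<open>0\<close>
      and is not confined to a small neighbourhood.\<close>
  define r0 where "r0 = - 2 - \<theta> * norm T"
  let ?h = "\<lambda>i. (1 / 2 :: real) ^ i"
  define root :: "('b \<Rightarrow>\<^sub>L real) \<times> real \<times> ('b \<Rightarrow> real) set" where "root = (0, r0, UNIV)"
  have norm_restr: "norm (restr x) \<le> norm x * norm T" for x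
    unfolding restr_def by (rule norm_blinfun_compose)
  have nb: "\<not> spoilable \<theta> x r" if "r \<le> - 1 - norm x" for x r
    using nb0 spoilable_mono[of \<theta> x r 0 "- 1"] that by auto
  have root_good: "good_state \<theta> dn 0 root"
  proof -
    have "\<not> spoilable \<theta> x (r0 + \<theta> * norm (restr (x - 0)) - \<theta> * (1 / 2) ^ 0)" if x: "norm x \<le> 1" for x
    proof (rule nb)
      have "norm (restr x) \<le> norm T"
        using norm_restr[of x] mult_right_mono[OF x, of "norm T"] by simp
      then have "\<theta> * norm (restr x) \<le> \<theta> * norm T"
        using \<theta> by (intro mult_left_mono) auto
      then show "r0 + \<theta> * norm (restr (x - 0)) - \<theta> * (1 / 2) ^ 0 \<le> - 1 - norm x"
        unfolding r0_def diff_zero power_0 mult_1_right using x \<theta> by linarith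
    qed
    moreover have "\<not> spoilable \<theta> 0 r0"
    proof (rule nb)
      have "0 \<le> \<theta> * norm T" using \<theta> by simp
      then show "r0 \<le> - 1 - norm (0 :: 'b \<Rightarrow>\<^sub>L real)"
        unfolding r0_def norm_zero by linarith
    qed
    ultimately show ?thesis
      by (auto simp: good_state_def root_def)
  qed
  have "\<exists>L. \<forall>n. ((finite (L n) \<and> (\<forall>s\<in>L n. good_state \<theta> dn n s) \<and> covers (L n)) \<and> (n = 0 \<longrightarrow> L n = {root})) \<and>
      (\<forall>s'\<in>L (Suc n). \<exists>s\<in>L n. child \<theta> n s s')"
  proof (rule dependent_nat_choice)
    show "\<exists>S. (finite S \<and> (\<forall>s\<in>S. good_state \<theta> dn 0 s) \<and> covers S) \<and> (0 = (0::nat) \<longrightarrow> S = {root})"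
      using root_good by (intro exI[of _ "{root}"]) (simp add: covers_def root_def)
    fix S n
    assume "(finite S \<and> (\<forall>s\<in>S. good_state \<theta> dn n s) \<and> covers S) \<and> (n = 0 \<longrightarrow> S = {root})"
    then show "\<exists>S'. ((finite S' \<and> (\<forall>s\<in>S'. good_state \<theta> dn (Suc n) s) \<and> covers S') \<and> (Suc n = 0 \<longrightarrow> S' = {root})) \<and>
        (\<forall>s'\<in>S'. \<exists>s\<in>S. child \<theta> n s s')"
      using next_level[of \<theta> S dn n] \<theta> by auto
  qed
  then obtain L where L: "\<forall>n. ((finite (L n) \<and> (\<forall>s\<in>L n. good_state \<theta> dn n s) \<and> covers (L n)) \<and> (n = 0 \<longrightarrow> L n = {root})) \<and>
      (\<forall>s'\<in>L (Suc n). \<exists>s\<in>L n. child \<theta> n s s')" ..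
  have Lfin: "finite (L n)" and Lcov: "covers (L n)" and L0: "L 0 = {root}" for n
    using L by simp_all
  have Lgood: "good_state \<theta> dn n s" if "s \<in> L n" for n s
    using L that by simp
  have Lchild: "\<exists>s\<in>L n. child \<theta> n s s'" if "s' \<in> L (Suc n)" for n s'
    using L that by simp
  define incr where "incr i s s' = (1 / max (norm (restr (fst s' - fst s))) (?h i)) *\<^sub>R restr (fst s' - fst s)"
    for i and s s' :: "('b \<Rightarrow>\<^sub>L real) \<times> real \<times> ('b \<Rightarrow> real) set"
  define A where "A i = (\<lambda>p. incr i (fst p) (snd p)) ` {p \<in> L i \<times> L (Suc i). child \<theta> i (fst p) (snd p)}" for i
  have h: "0 < ?h i" for i by simp
  have maxpos: "0 < max a (?h i)" for a i
    using h[of i] by (simp add: less_max_iff_disj)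
  have Afin: "finite (A i)" for i
    unfolding A_def using Lfin by (intro finite_imageI finite_subset[OF _ finite_cartesian_product[of "L i" "L (Suc i)"]]) auto
  have Anorm: "norm f \<le> 1" if f: "f \<in> A i" for f i
  proof -
    obtain s s' where "f = incr i s s'" using f by (auto simp: A_def)
    then show ?thesis
      using maxpos[of "norm (restr (fst s' - fst s))" i] by (simp add: incr_def divide_le_eq)
  qed
  have Asmall: "\<bar>f (dn j)\<bar> \<le> ?h i" if f: "f \<in> A i" and j: "j < i" for f i j
  proof -
    obtain s s' where s: "f = incr i s s'" "s \<in> L i" "child \<theta> i s s'"
      using f by (auto simp: A_def)
    define g where "g = restr (fst s' - fst s)"
    have "\<bar>g (dn j)\<bar> \<le> ?h i * ?h i"
      using Lgood[OF s(2)] s(3) j unfolding good_state_def child_def g_def by (simp add: split_beta)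
    also have "\<dots> \<le> ?h i * max (norm g) (?h i)"
      by (intro mult_left_mono) auto
    finally show ?thesis
      using maxpos[of "norm g" i]
      by (simp add: s(1) incr_def g_def[symmetric] blinfun.scaleR_left abs_mult divide_le_eq)
  qed
  define M where "M = (1 - r0) / \<theta> + 4"
  have norming: "norm (T x) \<le> M * m" if m: "\<And>i f. f \<in> A i \<Longrightarrow> \<bar>f x\<bar> \<le> m" and "0 \<le> m" for x m
  proof -
    have bound: "\<bar>fst s (T x)\<bar> \<le> m * ((fst (snd s) - r0) / \<theta> + 2 * (\<Sum>i<n. ?h i))" if "s \<in> L n" for n s
      using that
    proof (induction n arbitrary: s)
      case 0
      then show ?case using L0 by (simp add: root_def)
    next
      case (Suc n s')
      obtain s where s: "s \<in> L n" "child \<theta> n s s'"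
        using Lchild[OF Suc.prems] by blast
      define g where "g = restr (fst s' - fst s)"
      have "incr n s s' \<in> A n"
        using s Suc.prems by (force simp: A_def)
      then have "\<bar>incr n s s' x\<bar> \<le> m" by (rule m)
      then have "\<bar>g x\<bar> \<le> m * max (norm g) (?h n)"
        using maxpos[of "norm g" n]
        by (simp add: incr_def g_def[symmetric] blinfun.scaleR_left abs_mult divide_le_eq)
      also have "\<dots> \<le> m * (norm g + ?h n)"
        using \<open>0 \<le> m\<close> by (intro mult_left_mono) auto
      finally have g: "\<bar>g x\<bar> \<le> m * (norm g + ?h n)" .
      have "fst s' (T x) = fst s (T x) + g x"
        by (simp add: g_def restr_apply blinfun.diff_left)
      then have "\<bar>fst s' (T x)\<bar> \<le> \<bar>fst s (T x)\<bar> + \<bar>g x\<bar>"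
        by simp
      also have "\<dots> \<le> m * ((fst (snd s) - r0) / \<theta> + 2 * (\<Sum>i<n. ?h i)) + m * (norm g + ?h n)"
        by (intro add_mono Suc.IH s(1) g)
      also have "fst (snd s) = fst (snd s') - \<theta> * norm g + \<theta> * ?h n"
        using s(2) by (simp add: child_def g_def)
      also have "m * ((fst (snd s') - \<theta> * norm g + \<theta> * ?h n - r0) / \<theta> + 2 * (\<Sum>i<n. ?h i)) + m * (norm g + ?h n)
          = m * ((fst (snd s') - r0) / \<theta> + 2 * (\<Sum>i<Suc n. ?h i))"
        using \<theta> by (simp add: field_simps)
      finally show ?case .
    qed
    obtain b :: "'b \<Rightarrow>\<^sub>L real" where b: "norm b \<le> 1" "b (T x) = norm (T x)"
      using norming_functional[of "T x"] by metis
    have "norm (T x) \<le> M * m + e" if e: "0 < e" for e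
    proof -
      define e' where "e' = e / (2 * norm T + 1)"
      have e': "0 < e'" using e by (simp add: e'_def add_nonneg_pos)
      obtain j where j: "norm (x - dn j) < e'" using dense[OF e'] by blast
      obtain n0 where n0: "?h n0 < e'"
        using real_arch_pow_inv[OF e', of "1 / 2"] by auto
      define n where "n = max n0 (Suc j)"
      obtain s where s: "s \<in> L n" "blinfun_apply b \<in> snd (snd s)"
        using Lcov[of n] b(1) unfolding covers_def by blast
      obtain z r G where zrG: "s = (z, r, G)" by (cases s)
      have z: "norm z \<le> 1" "\<not> spoilable \<theta> z r" and "\<bar>restr (b - z) (dn j)\<bar> \<le> ?h n * ?h n"
        using Lgood[OF s(1)] b(1) s(2) by (auto simp: good_state_def zrG n_def)
      moreover have "?h n * ?h n \<le> ?h n0"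
      proof -
        have "?h n * ?h n \<le> 1 * ?h n"
          by (intro mult_right_mono) (auto simp: power_le_one)
        also have "\<dots> \<le> ?h n0"
          by (simp add: n_def power_decreasing)
        finally show ?thesis .
      qed
      ultimately have small: "\<bar>(b - z) (T (dn j))\<bar> \<le> e'"
        using n0 by (simp add: restr_apply)
      have "\<bar>(b - z) (T (x - dn j))\<bar> \<le> norm (b - z) * norm (T (x - dn j))"
        using norm_blinfun[of "b - z"] by simp
      also have "\<dots> \<le> 2 * (norm T * e')"
        using norm_triangle_ineq4[of b z] z b j
        by (intro mult_mono order_trans[OF norm_blinfun] mult_left_mono) auto
      finally have "\<bar>(b - z) (T x)\<bar> \<le> 2 * (norm T * e') + e'"
        using small by (simp add: blinfun.diff_right)
      also have "\<dots> = (2 * norm T + 1) * e'"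
        by (simp add: algebra_simps)
      also have "\<dots> = e"
        using add_nonneg_pos[of "2 * norm T" 1] by (simp add: e'_def)
      finally have 1: "norm (T x) \<le> \<bar>z (T x)\<bar> + e"
        using b(2) by (simp add: blinfun.diff_left)
      have "r \<le> 1"
        using z spoilable.short[of z r \<theta>] by linarith
      moreover have "(\<Sum>i<n. ?h i) \<le> 2"
        using sum_gp_strict[of "1 / 2 :: real" n] by simp
      ultimately have "(r - r0) / \<theta> + 2 * (\<Sum>i<n. ?h i) \<le> M"
        using \<theta> by (simp add: M_def divide_right_mono add_mono)
      then have "\<bar>z (T x)\<bar> \<le> m * M"
        using bound[OF s(1)] mult_left_mono[OF _ \<open>0 \<le> m\<close>] by (fastforce simp: zrG)
      with 1 show ?thesis by (simp add: mult.commute)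
    qed
    then show ?thesis by (rule field_le_epsilon)
  qed
  \<comment> \<open>Enumerate the union of the finite sets \<open>A i\<close>, padding with zeros.\<close>
  obtain xs where xs: "\<And>i. set (xs i) = A i"
    using finite_list[OF Afin] by metis
  define f where "f n = (case prod_decode n of (i, k) \<Rightarrow> if k < length (xs i) then xs i ! k else 0)" for n
  have f_A: "f n = 0 \<or> f n \<in> A (fst (prod_decode n))" for n
    by (auto simp: f_def split_beta xs[symmetric])
  have A_f: "\<exists>n. f n = g" if "g \<in> A i" for g i
  proof -
    obtain k where "k < length (xs i)" "xs i ! k = g"
      using \<open>g \<in> A i\<close> xs in_set_conv_nth by metis
    then show ?thesis
      by (intro exI[of _ "prod_encode (i, k)"]) (simp add: f_def)
  qed
  show thesis
  proof
    show "norm (f n) \<le> 1" for n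
      using f_A[of n] Anorm by auto
    show "norm (T x) \<le> M * m" if "\<And>n. \<bar>f n x\<bar> \<le> m" for x m
      by (rule norming) (use that A_f in \<open>metis, metis abs_ge_zero order_trans\<close>)
    show "(\<lambda>n. f n x) \<longlonglongrightarrow> 0" for x
    proof (rule tendstoI)
      fix e :: real assume "0 < e"
      then have e2: "0 < e / 2" by simp
      obtain j where j: "norm (x - dn j) < e / 2" using dense[OF e2] by blast
      obtain n0 where n0: "?h n0 < e / 2"
        using real_arch_pow_inv[OF e2, of "1 / 2"] by auto
      define i0 where "i0 = max n0 (Suc j)"
      have small: "\<bar>g x\<bar> < e" if g: "g \<in> A i" and i: "i0 \<le> i" for g i
      proof -
        have "\<bar>g (x - dn j)\<bar> \<le> norm g * norm (x - dn j)"
          using norm_blinfun[of g] by simp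
        also have "\<dots> \<le> norm (x - dn j)"
          using Anorm[OF g] by (simp add: mult_left_le_one_le)
        finally have "\<bar>g (x - dn j)\<bar> < e / 2" using j by simp
        moreover have "\<bar>g (dn j)\<bar> \<le> ?h i"
          using Asmall[OF g, of j] i by (simp add: i0_def)
        moreover have "?h i \<le> ?h n0"
          using i by (intro power_decreasing) (auto simp: i0_def)
        ultimately show ?thesis
          using n0 unfolding blinfun.diff_right by linarith
      qed
      have "{n. \<not> \<bar>f n x\<bar> < e} \<subseteq> prod_encode ` (SIGMA i:{..<i0}. {..<length (xs i)})"
      proof
        fix n assume n: "n \<in> {n. \<not> \<bar>f n x\<bar> < e}"
        obtain i k where ik: "prod_decode n = (i, k)" by fastforce
        have "f n \<noteq> 0" using n \<open>0 < e\<close> by auto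
        then have "k < length (xs i)" "f n \<in> A i"
          using f_A[of n] by (auto simp: f_def ik split: if_splits)
        moreover have "i < i0"
          using small[OF \<open>f n \<in> A i\<close>] n by force
        moreover have "n = prod_encode (i, k)"
          using ik by (metis prod_decode_inverse)
        ultimately show "n \<in> prod_encode ` (SIGMA i:{..<i0}. {..<length (xs i)})"
          by blast
      qed
      then have "finite {n. \<not> \<bar>f n x\<bar> < e}"
        by (rule finite_subset) auto
      then have "\<forall>\<^sub>F n in sequentially. \<bar>f n x\<bar> < e"
        by (simp add: cofinite_eq_sequentially[symmetric] eventually_cofinite)
      then show "\<forall>\<^sub>F n in sequentially. dist (f n x) 0 < e"
        by simp
    qed
  qed
qed

end

section \<open>The embedding into c0\<close>

text \<open>
  The embedding is \<open>x \<mapsto> (f\<^sub>n x)\<^sub>n\<close>.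
\<close>

lemma isomorphic_to_subspace_of_c0_if_norming_sequence:
  fixes f :: "nat \<Rightarrow> 'a::banach \<Rightarrow>\<^sub>L real"
  assumes norm: "\<And>n. norm (f n) \<le> 1" and null: "\<And>x. (\<lambda>n. f n x) \<longlonglongrightarrow> 0"
    and norming: "\<And>x m. (\<And>n. \<bar>f n x\<bar> \<le> m) \<Longrightarrow> norm x \<le> M * m"
  shows "isomorphic_to_subspace_of TYPE('a) c0"
proof -
  have le: "\<bar>f n x\<bar> \<le> norm x" for n x
    using norm_blinfun[of "f n" x] mult_right_mono[OF norm, of "norm x" n] by simp
  define J where "J x = Bcontfun (\<lambda>n. f n x)" for x
  have ap: "apply_bcontfun (J x) n = f n x" for x n
    unfolding J_def
    by (subst Bcontfun_inverse) (use le in \<open>auto intro: bcontfun_normI[of _ "norm x"]\<close>)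
  have ap_fun: "apply_bcontfun (J x) = (\<lambda>n. f n x)" for x
    using ap by (rule ext)
  have J_norm: "norm (J x) \<le> norm x" for x
    by (rule norm_bound) (simp add: ap le)
  have "bounded_linear J"
    by (rule bounded_linear_intro[where K = 1])
      (auto intro!: bcontfun_eqI simp: ap blinfun.add_right blinfun.scaleR_right J_norm)
  then interpret J: bounded_linear J .
  define M' where "M' = max M 1"
  have M': "0 < M'" by (simp add: M'_def)
  have low: "norm x \<le> M' * norm (J x)" for x
  proof -
    have "norm x \<le> M * norm (J x)"
      by (rule norming) (use norm_bounded[of "J x"] in \<open>simp add: ap\<close>)
    also have "\<dots> \<le> M' * norm (J x)"
      by (intro mult_right_mono) (auto simp: M'_def)
    finally show ?thesis .
  qed
  have inj: "x = y" if "J x = J y" for x y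
    using low[of "x - y"] that by (simp add: J.diff)
  have "complete (range J)"
  proof (rule complete_isometric_image[where e = "1 / M'"])
    show "\<forall>x\<in>UNIV. 1 / M' * norm x \<le> norm (J x)"
      using low M' by (simp add: field_simps)
  qed (use M' J.bounded_linear_axioms in \<open>auto simp: complete_UNIV\<close>)
  then have "closed (range J)" by (rule complete_imp_closed)
  moreover have "range J \<subseteq> c0"
    using null by (auto simp: c0_def ap_fun)
  moreover have "subspace (range J)"
    by (intro linear_subspace_image J.linear subspace_UNIV)
  moreover have "homeomorphism UNIV (range J) J (inv J)"
  proof (rule homeomorphismI)
    have invJ: "inv J (J x) = x" for x
      using inj by (simp add: inv_f_f injI)
    show "continuous_on UNIV J"
      by (rule J.continuous_on) (rule continuous_on_id)
    have "M'-lipschitz_on (range J) (inv J)"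
      using M' low by (intro lipschitz_onI) (auto simp: invJ dist_norm simp flip: J.diff)
    then show "continuous_on (range J) (inv J)"
      by (rule lipschitz_on_continuous_on)
    show "inv J (J x) = x" for x by (rule invJ)
    show "J (inv J y) = y" if "y \<in> range J" for y
      using that by (simp add: f_inv_into_f)
  qed auto
  ultimately show ?thesis
    unfolding isomorphic_to_subspace_of_def using J.linear by blast
qed

lemma unconditional_embedding_of_UFDD:
  fixes Q :: "nat \<Rightarrow> 'b::banach \<Rightarrow>\<^sub>L 'b" and T :: "'a::banach \<Rightarrow>\<^sub>L 'b"
  assumes Q: "is_UFDD Q" and Schur: "very_strong_Schur TYPE('a \<Rightarrow>\<^sub>L real)"
  obtains K where "unconditional_embedding T (\<lambda>k. Q k o\<^sub>L T) K"
proof -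
  have sum: "((\<lambda>k. (Q k o\<^sub>L T) x) has_sum T x) UNIV" for x
    using Q by (simp add: is_UFDD_def)
  obtain K where K: "0 < K" "\<And>F. F \<in> Collect finite \<Longrightarrow> norm (\<Sum>k\<in>F. Q k o\<^sub>L T) \<le> K"
  proof (rule banach_steinhaus[where I = "Collect finite" and f = "\<lambda>F. \<Sum>k\<in>F. Q k o\<^sub>L T"])
    show "\<exists>M. \<forall>F\<in>Collect finite. norm ((\<Sum>k\<in>F. Q k o\<^sub>L T) x) \<le> M" for x
      using bounded_partial_sums_if_has_sum[OF sum[of x]] by (simp add: blinfun.sum_left)
  qed (rule that)
  have rank: "\<exists>D E. 0 \<le> D \<and> finite E \<and>
      (\<forall>v. norm (v o\<^sub>L (Q k o\<^sub>L T)) \<le> D * (\<Sum>e\<in>E. \<bar>blinfun_apply v e\<bar>))" for k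
  proof -
    obtain D E where D: "0 \<le> D" "finite E"
      "\<And>v :: 'b \<Rightarrow>\<^sub>L real. norm (v o\<^sub>L Q k) \<le> D * (\<Sum>e\<in>E. \<bar>blinfun_apply v e\<bar>)"
      using finite_rank_comp_bound[of "Q k"] Q unfolding is_UFDD_def by metis
    have "norm (v o\<^sub>L (Q k o\<^sub>L T)) \<le> (D * norm T) * (\<Sum>e\<in>E. \<bar>blinfun_apply v e\<bar>)" for v :: "'b \<Rightarrow>\<^sub>L real"
    proof -
      have "norm ((v o\<^sub>L Q k) o\<^sub>L T) \<le> norm (v o\<^sub>L Q k) * norm T"
        by (rule norm_blinfun_compose)
      also have "\<dots> \<le> D * (\<Sum>e\<in>E. \<bar>blinfun_apply v e\<bar>) * norm T"
        by (intro mult_right_mono D) simp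
      also have "(v o\<^sub>L Q k) o\<^sub>L T = v o\<^sub>L (Q k o\<^sub>L T)"
        by (rule blinfun_eqI) simp
      finally show ?thesis
        by (simp add: ac_simps)
    qed
    then show ?thesis
      using D(1,2) by (intro exI[of _ "D * norm T"] exI[of _ E]) auto
  qed
  show thesis
    by (rule that[of K], unfold_locales) (use sum K rank Schur in auto)
qed

theorem theorem4p3:
  assumes "separable_space (euclidean :: 'a::banach topology)"
    and "very_strong_Schur TYPE('a \<Rightarrow>\<^sub>L real)"
    and "has_UFDD TYPE('b::banach)"
    and "isomorphic_to_subspace_of TYPE('a) (UNIV :: 'b set)"
  shows "isomorphic_to_subspace_of TYPE('a) c0"
proof -
  obtain T0 :: "'a \<Rightarrow> 'b" and T0' Z where T0: "linear T0" "homeomorphism UNIV Z T0 T0'"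
    using assms(4) unfolding isomorphic_to_subspace_of_def by blast
  have bl: "bounded_linear T0"
    using linear_homeomorphism_bounds(1)[OF T0] .
  obtain b where b: "\<And>x. norm x \<le> b * norm (T0 x)"
    using linear_homeomorphism_bounds(2)[OF T0] by blast
  define T where "T = Blinfun T0"
  have T: "blinfun_apply T = T0"
    unfolding T_def by (rule bounded_linear_Blinfun_apply[OF bl])
  obtain Q :: "nat \<Rightarrow> 'b \<Rightarrow>\<^sub>L 'b" where "is_UFDD Q"
    using assms(3) by (auto simp: has_UFDD_def)
  then obtain K where "unconditional_embedding T (\<lambda>k. Q k o\<^sub>L T) K"
    using unconditional_embedding_of_UFDD assms(2) by blast
  then interpret unconditional_embedding T "\<lambda>k. Q k o\<^sub>L T" K .
  obtain d :: "nat \<Rightarrow> 'a" where d: "\<And>x e. 0 < e \<Longrightarrow> \<exists>j. norm (x - d j) < e"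
    using dense_sequence[OF assms(1)] by blast
  obtain f :: "nat \<Rightarrow> 'a \<Rightarrow>\<^sub>L real" and M where f: "\<And>n. norm (f n) \<le> 1"
    "\<And>x. (\<lambda>n. f n x) \<longlonglongrightarrow> 0" "\<And>x m. (\<And>n. \<bar>f n x\<bar> \<le> m) \<Longrightarrow> norm (T x) \<le> M * m"
    using weak_star_null_norming_sequence[OF d] by blast
  show ?thesis
  proof (rule isomorphic_to_subspace_of_c0_if_norming_sequence[OF f(1,2)])
    fix x m assume m: "\<And>n. \<bar>f n x\<bar> \<le> m"
    have "norm x \<le> \<bar>b\<bar> * norm (T x)"
      using b[of x] mult_right_mono[OF abs_ge_self[of b], of "norm (T0 x)"] by (simp add: T)
    also have "\<dots> \<le> \<bar>b\<bar> * (M * m)"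
      by (intro mult_left_mono f(3) m) auto
    finally show "norm x \<le> (\<bar>b\<bar> * M) * m" by (simp add: mult.assoc)
  qed
qed

end
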